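(* Let $t<s\le n/2$ be integers (with $n$ sufficiently large) such that $s\le e^{2t}$, and suppose that at least one of the following holds: (a) there is a constant $\delta>0$ with $(s/t)^{1-\delta}\ge \log n$; or (b) $s/t\ge c\log n$ for some constant $c>0$, and there is a constant $\gamma>0$ with $\log t\ge (\log n)^{\gamma}$. Then there exists a graph $G$ on $n$ vertices with $$\alpha(G)\le C\,\frac{t}{\log (s/t)}\log (n/t),$$ where $C$ is a constant (depending only on the constants $\delta$, respectively $c,\gamma$), such that every induced subgraph of $G$ on $s$ vertices contains an independent set of size $t$.
   Context: All logarithms are natural. $\alpha(G)$ denotes the maximum size of an independent set in $G$. The statement is asymptotic: $n$ is large and the implied constant in the bound on $\alpha(G)$ does not depend on $n,s,t$. *)

theory Defs
  imports Complex_Main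
begin

definition graph_on :: "nat \<Rightarrow> (nat \<Rightarrow> nat \<Rightarrow> bool) \<Rightarrow> bool" where
  "graph_on n E \<longleftrightarrow> (\<forall>u v. E u v \<longrightarrow> u < n \<and> v < n) \<and>
                       (\<forall>u v. E u v \<longrightarrow> E v u) \<and> (\<forall>u. \<not> E u u)"

definition indep_set :: "(nat \<Rightarrow> nat \<Rightarrow> bool) \<Rightarrow> nat set \<Rightarrow> bool" where
  "indep_set E S \<longleftrightarrow> (\<forall>u\<in>S. \<forall>v\<in>S. \<not> E u v)"

definition alpha :: "nat \<Rightarrow> (nat \<Rightarrow> nat \<Rightarrow> bool) \<Rightarrow> nat" where
  "alpha n E = Max {card S | S. S \<subseteq> {..<n} \<and> indep_set E S}"

definition s_t_property :: "nat \<Rightarrow> (nat \<Rightarrow> nat \<Rightarrow> bool) \<Rightarrow> nat \<Rightarrow> nat \<Rightarrow> bool" where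
  "s_t_property n E s t \<longleftrightarrow>
     (\<forall>S. S \<subseteq> {..<n} \<and> card S = s \<longrightarrow> (\<exists>I\<subseteq>S. card I = t \<and> indep_set E I))"

end

theory Submission
  imports Defs "HOL-Library.FuncSet" "HOL-Library.Disjoint_Sets" "HOL-Real_Asymp.Real_Asymp"
begin

text \<open>Put \<open>x = s / t\<close> and take the random graph on \<open>n\<close> vertices of density \<open>p = \<epsilon> ln x / t\<close>. Its
  independence number is \<open>O(ln (n / t) / p)\<close>, so it remains to show that an \<open>s\<close>-set \<open>S\<close> lacks an independent
  \<open>t\<close>-subset with probability much smaller than \<open>n\<close> to the power \<open>- s\<close>.

  If \<open>x\<close> is at least a power of \<open>ln n\<close> with exponent greater than 1, split off maximal independent sets of \<open>S\<close>
  one after the other. If all of them have size at most \<open>t\<close>, there are about \<open>x / 2\<close> rounds before half of \<open>S\<close> is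
  used up, and in each round every remaining vertex has a neighbour in the current set. These events concern
  disjoint sets of pairs, and each has probability at most \<open>1 - (1 - p)\<^sup>t\<close>.

  If \<open>x\<close> is between \<open>c ln n\<close> and the square of \<open>ln n\<close>, let \<open>d = s p\<close>. As \<open>t\<close> is large, with sufficiently large
  probability \<open>S\<close> spans \<open>O(s d)\<close> edges and contains fewer than \<open>s d / h\<close> edge-disjoint triangles, where \<open>h\<close> is a
  small power of \<open>d\<close>. Hence few edges meet all triangles, and a colour class of a suitable colouring of \<open>S\<close> with
  \<open>O(d / h)\<close> colours becomes triangle-free of maximum degree \<open>h\<close> after the deletion of few vertices. The theorem of
  Ajtai, Komlos and Szemeredi on triangle-free graphs gains the factor \<open>ln h\<close>, which is of order \<open>ln x\<close>.\<close>

section \<open>Random subsets of a finite set\<close>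

text \<open>Probabilities are finite sums of such weights, so independence becomes an algebraic
  identity.\<close>

definition weight :: "real \<Rightarrow> 'a set \<Rightarrow> 'a set \<Rightarrow> real" where
  "weight p U F = p ^ card F * (1 - p) ^ card (U - F)"

text \<open>\<open>pr p U Q\<close> is the probability that \<open>Q\<close> holds for the random subset of \<open>U\<close> containing each element
  independently with probability \<open>p\<close>.\<close>

definition pr :: "real \<Rightarrow> 'a set \<Rightarrow> ('a set \<Rightarrow> bool) \<Rightarrow> real" where
  "pr p U Q = (\<Sum>F\<in>{F. F \<subseteq> U \<and> Q F}. weight p U F)"

lemma weight_nonneg: "0 \<le> p \<Longrightarrow> p \<le> 1 \<Longrightarrow> 0 \<le> weight p U F"
  by (simp add: weight_def)

lemma pr_cong: "(\<And>F. F \<subseteq> U \<Longrightarrow> Q F = R F) \<Longrightarrow> pr p U Q = pr p U R"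
  unfolding pr_def by (rule sum.cong) auto

lemma pr_mono:
  assumes "finite U" "0 \<le> p" "p \<le> 1" "\<And>F. F \<subseteq> U \<Longrightarrow> Q F \<Longrightarrow> R F"
  shows "pr p U Q \<le> pr p U R"
  unfolding pr_def using assms by (intro sum_mono2 weight_nonneg) auto

lemma pr_union:
  assumes "finite U" "0 \<le> p" "p \<le> 1" "finite I"
  shows "pr p U (\<lambda>F. \<exists>i\<in>I. Q i F) \<le> (\<Sum>i\<in>I. pr p U (Q i))"
proof -
  have "{F. F \<subseteq> U \<and> (\<exists>i\<in>I. Q i F)} = (\<Union>i\<in>I. {F. F \<subseteq> U \<and> Q i F})" by auto
  then have "pr p U (\<lambda>F. \<exists>i\<in>I. Q i F) = sum (weight p U) (\<Union>i\<in>I. {F. F \<subseteq> U \<and> Q i F})"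
    by (simp add: pr_def)
  also have "\<dots> \<le> (\<Sum>i\<in>I. sum (weight p U) {F. F \<subseteq> U \<and> Q i F})"
    using assms(4)
  proof (induction I rule: finite_induct)
    case empty show ?case by simp
  next
    case (insert j I)
    let ?A = "\<lambda>i. {F. F \<subseteq> U \<and> Q i F}"
    have fin: "finite (?A i)" for i using assms(1) by simp
    have "sum (weight p U) (?A j \<union> (\<Union>i\<in>I. ?A i)) \<le> sum (weight p U) (?A j) + sum (weight p U) (\<Union>i\<in>I. ?A i)"
      by (subst sum_Un) (use insert fin assms in \<open>auto intro!: sum_nonneg weight_nonneg\<close>)
    with insert show ?case by simp
  qed
  finally show ?thesis by (simp add: pr_def)
qed

lemma pr_union_bound:
  assumes "finite U" "0 \<le> p" "p \<le> 1" "finite I" "\<And>i. i \<in> I \<Longrightarrow> pr p U (Q i) \<le> b"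
  shows "pr p U (\<lambda>F. \<exists>i\<in>I. Q i F) \<le> real (card I) * b"
  using order_trans[OF pr_union[OF assms(1-4)] sum_bounded_above[of I "\<lambda>i. pr p U (Q i)" b]] assms(5)
  by simp

lemma pr_disj:
  assumes "finite U" "0 \<le> p" "p \<le> 1"
  shows "pr p U (\<lambda>F. Q F \<or> R F) \<le> pr p U Q + pr p U R"
  using pr_union[OF assms, of UNIV "\<lambda>b. if b then Q else R"]
  by (simp add: ex_bool_eq UNIV_bool disj_commute)

text \<open>Independence of events on disjoint coordinate sets: \<open>F\<close> corresponds to the
  pair of its traces on \<open>A\<close> and \<open>B\<close>, and the weight is multiplicative
  along this bijection.\<close>

lemma pr_product:
  assumes "finite A" "finite B" "A \<inter> B = {}"
  shows "pr p (A \<union> B) (\<lambda>F. Q (F \<inter> A) \<and> R (F \<inter> B)) = pr p A Q * pr p B R"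
proof -
  let ?X = "{F. F \<subseteq> A \<and> Q F}" and ?Y = "{F. F \<subseteq> B \<and> R F}"
  have "pr p A Q * pr p B R = (\<Sum>(F, G)\<in>?X \<times> ?Y. weight p A F * weight p B G)"
    by (simp add: pr_def sum_product sum.cartesian_product)
  also have "\<dots> = (\<Sum>F\<in>{F. F \<subseteq> A \<union> B \<and> Q (F \<inter> A) \<and> R (F \<inter> B)}. weight p (A \<union> B) F)"
  proof (rule sum.reindex_bij_witness[where j = "\<lambda>(F, G). F \<union> G" and i = "\<lambda>F. (F \<inter> A, F \<inter> B)"])
    fix z assume z: "z \<in> ?X \<times> ?Y"
    then obtain F G where zz: "z = (F, G)" "F \<subseteq> A" "G \<subseteq> B" "Q F" "R G" by auto
    have e: "(F \<union> G) \<inter> A = F" "(F \<union> G) \<inter> B = G" using zz assms by auto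
    have fin: "finite F" "finite G" using zz assms by (auto intro: rev_finite_subset)
    have c1: "card (F \<union> G) = card F + card G" using fin zz assms by (intro card_Un_disjoint) auto
    have "A \<union> B - (F \<union> G) = (A - F) \<union> (B - G)" using zz assms by auto
    then have c2: "card (A \<union> B - (F \<union> G)) = card (A - F) + card (B - G)"
      using assms by (simp add: card_Un_disjoint disjoint_iff)
    show "((case z of (F, G) \<Rightarrow> F \<union> G) \<inter> A, (case z of (F, G) \<Rightarrow> F \<union> G) \<inter> B) = z"
      using zz e by simp
    show "(case z of (F, G) \<Rightarrow> F \<union> G) \<in> {F. F \<subseteq> A \<union> B \<and> Q (F \<inter> A) \<and> R (F \<inter> B)}"
      using zz e by auto
    show "weight p (A \<union> B) (case z of (F, G) \<Rightarrow> F \<union> G) = (case z of (F, G) \<Rightarrow> weight p A F * weight p B G)"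
      using zz c1 c2 by (simp add: weight_def power_add)
  qed auto
  finally show ?thesis by (simp add: pr_def)
qed

lemma pr_True:
  assumes "finite U" shows "pr p U (\<lambda>F. True) = 1"
  using assms
proof (induction U rule: finite_induct)
  case empty
  show ?case by (simp add: pr_def weight_def)
next
  case (insert a U)
  have "{F. F \<subseteq> {a}} = {{}, {a}}" by auto
  then have "pr p {a} (\<lambda>F. True) = 1" by (simp add: pr_def weight_def)
  with insert pr_product[of "{a}" U p "\<lambda>_. True" "\<lambda>_. True"] show ?case by simp
qed

text \<open>The coordinates outside \<open>T\<close> form an independent factor of total probability
  1.\<close>

lemma pr_local:
  assumes "finite U" "T \<subseteq> U"
  shows "pr p U (\<lambda>F. Q (F \<inter> T)) = pr p T Q"
proof -
  have fin: "finite T" "finite (U - T)" using assms by (auto intro: rev_finite_subset)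
  have "T \<union> (U - T) = U" using assms by auto
  with pr_product[OF fin, of p Q "\<lambda>_. True"] pr_True[OF fin(2)] show ?thesis by simp
qed

lemma pr_subset:
  assumes "finite U" "T \<subseteq> U" shows "pr p U (\<lambda>F. T \<subseteq> F) = p ^ card T"
proof -
  have "pr p U (\<lambda>F. T \<subseteq> F) = pr p U (\<lambda>F. T \<subseteq> F \<inter> T)" by (rule pr_cong) auto
  also have "\<dots> = pr p T (\<lambda>F. T \<subseteq> F)" by (rule pr_local[OF assms])
  also have "{F. F \<subseteq> T \<and> T \<subseteq> F} = {T}" by auto
  then have "pr p T (\<lambda>F. T \<subseteq> F) = p ^ card T" by (simp add: pr_def weight_def)
  finally show ?thesis .
qed

lemma pr_avoid:
  assumes "finite U" "T \<subseteq> U" shows "pr p U (\<lambda>F. F \<inter> T = {}) = (1 - p) ^ card T"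
proof -
  have "{F. F \<subseteq> T \<and> F = {}} = {{}}" by auto
  then have "pr p T (\<lambda>F. F = {}) = (1 - p) ^ card T" by (simp add: pr_def weight_def)
  with pr_local[OF assms, of p "\<lambda>F. F = {}"] show ?thesis by simp
qed

lemma pr_hit:
  assumes "finite U" "T \<subseteq> U" shows "pr p U (\<lambda>F. F \<inter> T \<noteq> {}) = 1 - (1 - p) ^ card T"
proof -
  have "pr p U (\<lambda>_. True) = sum (weight p U) ({F. F \<subseteq> U \<and> F \<inter> T = {}} \<union> {F. F \<subseteq> U \<and> F \<inter> T \<noteq> {}})"
    unfolding pr_def by (rule sum.cong) auto
  also have "sum (weight p U) ({F. F \<subseteq> U \<and> F \<inter> T = {}} \<union> {F. F \<subseteq> U \<and> F \<inter> T \<noteq> {}})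
      = pr p U (\<lambda>F. F \<inter> T = {}) + pr p U (\<lambda>F. F \<inter> T \<noteq> {})"
    unfolding pr_def by (rule sum.union_disjoint) (use assms(1) in auto)
  finally show ?thesis using pr_True[OF assms(1)] pr_avoid[OF assms] by simp
qed

text \<open>Mutual independence by induction: \<open>T k\<close> is split off, and disjointness puts
  every other \<open>T j\<close> into the rest of \<open>U\<close>.\<close>

lemma pr_hit_all:
  assumes "finite K" "finite U" "\<And>k. k \<in> K \<Longrightarrow> T k \<subseteq> U" "disjoint_family_on T K"
  shows "pr p U (\<lambda>F. \<forall>k\<in>K. F \<inter> T k \<noteq> {}) = (\<Prod>k\<in>K. 1 - (1 - p) ^ card (T k))"
  using assms
proof (induction K arbitrary: U rule: finite_induct)
  case empty
  then show ?case by (simp add: pr_True)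
next
  case (insert k K)
  let ?V = "U - T k"
  have fin: "finite (T k)" "finite ?V"
    using insert.prems(1) insert.prems(2)[of k] by (auto intro: rev_finite_subset)
  have sub: "T j \<subseteq> ?V" if "j \<in> K" for j
  proof -
    have "j \<noteq> k" using that insert.hyps by blast
    then have "T j \<inter> T k = {}" using that insert.prems(3) by (simp add: disjoint_family_on_def)
    with that insert.prems(2)[of j] show ?thesis by auto
  qed
  have un: "T k \<union> ?V = U" using insert.prems(2)[of k] by auto
  have "pr p U (\<lambda>F. \<forall>j\<in>insert k K. F \<inter> T j \<noteq> {})
      = pr p (T k \<union> ?V) (\<lambda>F. F \<inter> T k \<inter> T k \<noteq> {} \<and> (\<forall>j\<in>K. F \<inter> ?V \<inter> T j \<noteq> {}))"
    unfolding un
  proof (rule pr_cong)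
    fix F
    have "F \<inter> ?V \<inter> T j = F \<inter> T j" if "j \<in> K" for j using sub[OF that] by blast
    then show "(\<forall>j\<in>insert k K. F \<inter> T j \<noteq> {}) = (F \<inter> T k \<inter> T k \<noteq> {} \<and> (\<forall>j\<in>K. F \<inter> ?V \<inter> T j \<noteq> {}))"
      by simp
  qed
  also have "\<dots> = pr p (T k) (\<lambda>F. F \<inter> T k \<noteq> {}) * pr p ?V (\<lambda>F. \<forall>j\<in>K. F \<inter> T j \<noteq> {})"
    by (rule pr_product[OF fin]) auto
  also have "pr p ?V (\<lambda>F. \<forall>j\<in>K. F \<inter> T j \<noteq> {}) = (\<Prod>j\<in>K. 1 - (1 - p) ^ card (T j))"
    using insert.prems(3) by (intro insert.IH fin sub) (auto simp: disjoint_family_on_def)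
  finally show ?case using insert.hyps pr_hit[OF fin(1) order_refl] by simp
qed

text \<open>The step from probability to existence: an event containing every subset of
  \<open>U\<close> would have probability 1.\<close>

lemma pr_less_one_ex:
  assumes "finite U" "pr p U Q < 1" obtains F where "F \<subseteq> U" "\<not> Q F"
proof -
  have "\<exists>F\<subseteq>U. \<not> Q F"
  proof (rule ccontr)
    assume "\<not> ?thesis"
    then have "pr p U Q = pr p U (\<lambda>_. True)" by (intro pr_cong) auto
    with assms pr_True show False by fastforce
  qed
  with that show ?thesis by blast
qed

section \<open>Independent sets in nearly triangle-free graphs\<close>

text \<open>Inequality for one fibre of the counting argument below, \<open>m\<close> being the
  number of uncovered neighbours: the fibre has \<open>2 ^ m + 1\<close> members, and
  \<open>m * 2 ^ m / 2\<close> is the total size of all subsets of an \<open>m\<close>-set. Small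
  \<open>2 ^ m\<close> is paid for by \<open>D\<close> alone; otherwise \<open>m\<close> is at least
  of order \<open>ln D\<close>.\<close>

lemma ln_times_power_two_le:
  fixes D :: real assumes "1 \<le> D"
  shows "ln D / 8 * (2 ^ m + 1) \<le> D + real m * 2 ^ m / 2"
proof (cases "(2::real) ^ m \<le> sqrt D")
  case True
  have s: "1 \<le> sqrt D" "sqrt D * sqrt D = D" using assms by auto
  have "ln D = 2 * ln (sqrt D)" using assms by (simp add: ln_sqrt)
  also have "\<dots> \<le> 2 * sqrt D" using s ln_le_minus_one[of "sqrt D"] by linarith
  finally have "ln D / 8 \<le> sqrt D / 4" by simp
  moreover have "(2::real) ^ m + 1 \<le> 2 * sqrt D" using True s by linarith
  ultimately have "ln D / 8 * (2 ^ m + 1) \<le> sqrt D / 4 * (2 * sqrt D)"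
    using s assms by (intro mult_mono) auto
  also have "\<dots> \<le> D" using s assms by (simp add: field_simps)
  also have "\<dots> \<le> D + real m * 2 ^ m / 2" by simp
  finally show ?thesis .
next
  case False
  have s: "1 \<le> sqrt D" using assms by auto
  have "ln (sqrt D) \<le> ln (2 ^ m)" using False s by (subst ln_le_cancel_iff) auto
  also have "\<dots> = real m * ln 2" by (simp add: ln_realpow)
  also have "\<dots> \<le> real m" using ln_2_less_1 by (simp add: mult_left_le)
  finally have "ln D / 8 \<le> real m / 4" using assms by (simp add: ln_sqrt)
  then have "ln D / 8 * (2 ^ m + 1) \<le> real m / 4 * (2 * 2 ^ m)"
    by (intro mult_mono) (use assms in auto)
  also have "\<dots> \<le> D + real m * 2 ^ m / 2" using assms by simp
  finally show ?thesis .
qed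

lemma sum_card_Pow:
  assumes "finite X" shows "(\<Sum>Y\<in>Pow X. real (card Y)) = real (card X) * 2 ^ card X / 2"
  using assms
proof (induction X rule: finite_induct)
  case empty show ?case by simp
next
  case (insert a X)
  have fin: "Y \<subseteq> X \<Longrightarrow> finite Y" for Y using insert.hyps(1) finite_subset by blast
  have "(\<Sum>Y\<in>Pow (insert a X). real (card Y)) = (\<Sum>Y\<in>Pow X. real (card Y)) + (\<Sum>Y\<in>insert a ` Pow X. real (card Y))"
    unfolding Pow_insert by (rule sum.union_disjoint) (use insert.hyps in auto)
  also have "(\<Sum>Y\<in>insert a ` Pow X. real (card Y)) = (\<Sum>Y\<in>Pow X. real (card (insert a Y)))"
    by (rule sum.reindex_cong[where l = "insert a"]) (use insert.hyps in \<open>auto simp: inj_on_def\<close>)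
  also have "\<dots> = (\<Sum>Y\<in>Pow X. real (card Y) + 1)"
  proof (rule sum.cong)
    fix Y assume Y: "Y \<in> Pow X"
    then have "finite Y" "a \<notin> Y" using fin insert.hyps by auto
    then show "real (card (insert a Y)) = real (card Y) + 1" by simp
  qed simp
  also have "\<dots> = (\<Sum>Y\<in>Pow X. real (card Y)) + 2 ^ card X"
    using insert.hyps by (simp add: sum.distrib card_Pow)
  finally show ?case using insert by (simp add: field_simps)
qed

text \<open>For a vertex \<^term>\<open>v\<close> fix the part of a random independent set outside the closed neighbourhood of
  \<^term>\<open>v\<close>; as the neighbourhood is independent, the set extends either by \<^term>\<open>v\<close> or by an arbitrary set of
  uncovered neighbours.\<close>

lemma sum_indep_sets_vertex:
  fixes E :: "'a \<Rightarrow> 'a \<Rightarrow> bool" and D :: real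
  defines "indep \<equiv> \<lambda>W. \<forall>u\<in>W. \<forall>w\<in>W. \<not> E u w"
  assumes fin: "finite V" and v: "v \<in> V" and sym: "\<And>u w. E u w \<Longrightarrow> E w u" and irr: "\<And>u. \<not> E u u"
    and tri: "\<And>a b. a \<in> V \<Longrightarrow> b \<in> V \<Longrightarrow> E v a \<Longrightarrow> E v b \<Longrightarrow> \<not> E a b"
    and D: "1 \<le> D"
  shows "ln D / 8 * real (card {W. W \<subseteq> V \<and> indep W}) \<le>
    (\<Sum>W | W \<subseteq> V \<and> indep W. (if v \<in> W then D else 0) + real (card {w \<in> W. E v w}))"
proof -
  let ?I = "{W. W \<subseteq> V \<and> indep W}"
  let ?N = "{w \<in> V. E v w}"
  define g where "g W = W - insert v ?N" for W
  define h where "h W = (if v \<in> W then D else 0) + real (card {w \<in> W. E v w})" for W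
  have finI: "finite ?I" using fin by simp
  have fib: "ln D / 8 * real (card {W \<in> ?I. g W = J}) \<le> sum h {W \<in> ?I. g W = J}" if J: "J \<in> g ` ?I" for J
  proof -
    have JV: "J \<subseteq> V" "indep J" "J \<inter> insert v ?N = {}"
      using J unfolding g_def indep_def by auto
    \<comment> \<open>\<open>X\<close> consists of the neighbours of \<open>v\<close> that remain
      available once \<open>J\<close> is fixed.\<close>
    define X where "X = {w \<in> ?N. \<forall>u\<in>J. \<not> E w u}"
    have XN: "X \<subseteq> ?N" and finX: "finite X" using fin unfolding X_def by auto
    have vX: "v \<notin> X" "v \<notin> J" "J \<inter> X = {}" using irr JV XN by auto
    have nvJ: "\<not> E v w" if "w \<in> J" for w using that JV by auto
    have eq: "{W \<in> ?I. g W = J} = insert (insert v J) ((\<lambda>Y. J \<union> Y) ` Pow X)" (is "?L = ?R")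
    proof (intro equalityI subsetI)
      fix W assume W: "W \<in> ?L"
      then have WW: "W \<subseteq> V" "indep W" "J = W - insert v ?N" by (auto simp: g_def)
      show "W \<in> ?R"
      proof (cases "v \<in> W")
        case True
        then have "W \<inter> ?N = {}" using WW unfolding indep_def by auto
        then have "W = insert v J" using True WW by auto
        then show ?thesis by simp
      next
        case False
        have "W \<inter> ?N \<subseteq> X" using WW unfolding X_def indep_def by auto
        moreover have "W = J \<union> (W \<inter> ?N)" using False WW by auto
        ultimately show ?thesis by blast
      qed
    next
      fix W assume W: "W \<in> ?R"
      then consider "W = insert v J" | Y where "Y \<subseteq> X" "W = J \<union> Y" by auto
      then show "W \<in> ?L"
      proof cases
        case 1
        have "indep W" using 1 JV(2) nvJ sym irr unfolding indep_def by blast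
        moreover have "g W = J" using 1 JV by (auto simp: g_def)
        ultimately show ?thesis using 1 JV v by auto
      next
        case 2
        \<comment> \<open>Two adjacent neighbours of \<open>v\<close> would close a triangle, so any
          subset of \<open>X\<close> may be added to \<open>J\<close>.\<close>
        have YY: "\<not> E a b" if "a \<in> Y" "b \<in> Y" for a b using tri[of a b] that 2 XN by auto
        have YJ: "\<not> E a b" if "a \<in> Y" "b \<in> J" for a b using that 2 unfolding X_def by auto
        have "indep W" using 2 JV(2) YY YJ sym unfolding indep_def by blast
        moreover have "g W = J" using 2 JV XN by (auto simp: g_def)
        ultimately show ?thesis using 2 JV XN by auto
      qed
    qed
    have notin: "insert v J \<notin> (\<lambda>Y. J \<union> Y) ` Pow X" using vX by auto
    have inj: "inj_on (\<lambda>Y. J \<union> Y) (Pow X)" using vX(3) unfolding inj_on_def by blast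
    have c: "card {W \<in> ?I. g W = J} = 2 ^ card X + 1"
      unfolding eq using notin inj finX by (simp add: card_image card_Pow)
    have hY: "h (J \<union> Y) = real (card Y)" if "Y \<in> Pow X" for Y
    proof -
      have "{w \<in> J \<union> Y. E v w} = Y" using that XN nvJ by auto
      then show ?thesis using that vX by (auto simp: h_def)
    qed
    have hv: "h (insert v J) = D"
    proof -
      have "{w \<in> insert v J. E v w} = {}" using nvJ irr by auto
      then show ?thesis unfolding h_def by (simp only:) simp
    qed
    have "sum h {W \<in> ?I. g W = J} = D + (\<Sum>Y\<in>Pow X. real (card Y))"
      unfolding eq using notin inj finX by (simp add: hv sum.reindex hY)
    moreover have "real (card {W \<in> ?I. g W = J}) = 2 ^ card X + 1" by (simp only: c) simp
    ultimately show ?thesis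
      using ln_times_power_two_le[OF D, of "card X"] sum_card_Pow[OF finX] by presburger
  qed
  have "real (card ?I) = (\<Sum>J\<in>g ` ?I. real (card {W \<in> ?I. g W = J}))"
    using sum.image_gen[OF finI, of "\<lambda>_. 1::real" g] by simp
  then have "ln D / 8 * real (card ?I) = (\<Sum>J\<in>g ` ?I. ln D / 8 * real (card {W \<in> ?I. g W = J}))"
    by (simp only: sum_distrib_left)
  also have "\<dots> \<le> (\<Sum>J\<in>g ` ?I. sum h {W \<in> ?I. g W = J})"
    by (intro sum_mono fib)
  also have "\<dots> = sum h ?I" by (rule sum.image_gen[OF finI, symmetric])
  finally show ?thesis by (simp add: h_def)
qed

text \<open>A form of the Ajtai-Komlos-Szemeredi bound, by averaging over all independent sets: the
  vertex inequality is summed over \<open>v\<close>, and in the double sum each \<open>W\<close>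
  receives \<open>D * card W\<close> from membership and at most as much from degrees. Some
  \<open>W\<close> reaches the average.\<close>

lemma triangle_free_indep_set:
  fixes E :: "'a \<Rightarrow> 'a \<Rightarrow> bool" and D :: real
  assumes fin: "finite V" and sym: "\<And>u w. E u w \<Longrightarrow> E w u" and irr: "\<And>u. \<not> E u u"
    and tri: "\<And>a b c. a \<in> V \<Longrightarrow> b \<in> V \<Longrightarrow> c \<in> V \<Longrightarrow> E a b \<Longrightarrow> E a c \<Longrightarrow> \<not> E b c"
    and deg: "\<And>v. v \<in> V \<Longrightarrow> real (card {w \<in> V. E v w}) \<le> D"
    and D: "1 \<le> D"
  obtains W where "W \<subseteq> V" "\<forall>u\<in>W. \<forall>w\<in>W. \<not> E u w" "ln D / (16 * D) * real (card V) \<le> real (card W)"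
proof -
  let ?I = "{W. W \<subseteq> V \<and> (\<forall>u\<in>W. \<forall>w\<in>W. \<not> E u w)}"
  have finI: "finite ?I" using fin by simp
  have ne: "{} \<in> ?I" by simp
  have "real (card V) * (ln D / 8 * real (card ?I)) = (\<Sum>v\<in>V. ln D / 8 * real (card ?I))" by simp
  also have "\<dots> \<le> (\<Sum>v\<in>V. \<Sum>W\<in>?I. (if v \<in> W then D else 0) + real (card {w \<in> W. E v w}))"
  proof (rule sum_mono)
    fix v assume v: "v \<in> V"
    show "ln D / 8 * real (card ?I) \<le> (\<Sum>W\<in>?I. (if v \<in> W then D else 0) + real (card {w \<in> W. E v w}))"
      by (rule sum_indep_sets_vertex[OF fin v sym irr _ D]) (use tri[OF v] in auto)
  qed
  also have "\<dots> = (\<Sum>W\<in>?I. \<Sum>v\<in>V. (if v \<in> W then D else 0) + real (card {w \<in> W. E v w}))"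
    by (rule sum.swap)
  also have "\<dots> \<le> (\<Sum>W\<in>?I. 2 * D * real (card W))"
  proof (rule sum_mono)
    fix W assume W: "W \<in> ?I"
    then have finW: "finite W" and WV: "W \<subseteq> V" using fin finite_subset by auto
    have "(\<Sum>v\<in>V. if v \<in> W then D else 0) = (\<Sum>v\<in>V \<inter> W. D)"
      by (rule sum.inter_restrict[OF fin, symmetric])
    also have "V \<inter> W = W" using WV by auto
    finally have 1: "(\<Sum>v\<in>V. if v \<in> W then D else 0) = D * real (card W)" by simp
    \<comment> \<open>Double counting of adjacent pairs \<open>v\<close>, \<open>w\<close> with
      \<open>w\<close> in \<open>W\<close>, so that the degree bound applies to the vertices of
      \<open>W\<close>.\<close>
    have "(\<Sum>v\<in>V. real (card {w \<in> W. E v w})) = (\<Sum>v\<in>V. \<Sum>w\<in>W. if E v w then 1 else 0)"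
      using finW by (simp add: sum.If_cases Int_def)
    also have "\<dots> = (\<Sum>w\<in>W. \<Sum>v\<in>V. if E v w then 1 else 0)" by (rule sum.swap)
    also have "\<dots> = (\<Sum>w\<in>W. real (card {v \<in> V. E w v}))"
      using fin sym by (intro sum.cong) (auto simp: sum.If_cases Int_def intro!: arg_cong[where f = card])
    also have "\<dots> \<le> (\<Sum>w\<in>W. D)" using deg WV by (intro sum_mono) auto
    finally have 2: "(\<Sum>v\<in>V. real (card {w \<in> W. E v w})) \<le> D * real (card W)" by (simp add: mult.commute)
    show "(\<Sum>v\<in>V. (if v \<in> W then D else 0) + real (card {w \<in> W. E v w})) \<le> 2 * D * real (card W)"
      using 1 2 by (simp add: sum.distrib)
  qed
  finally have sum_le: "(\<Sum>W\<in>?I. real (card V) * ln D / 8) \<le> (\<Sum>W\<in>?I. 2 * D * real (card W))"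
    by (simp add: mult_ac)
  have "\<exists>W\<in>?I. real (card V) * ln D / 8 \<le> 2 * D * real (card W)"
  proof (rule ccontr)
    assume "\<not> ?thesis"
    then have "(\<Sum>W\<in>?I. 2 * D * real (card W)) < (\<Sum>W\<in>?I. real (card V) * ln D / 8)"
      using finI ne by (intro sum_strict_mono) (auto simp: not_le)
    with sum_le show False by simp
  qed
  then obtain W where "W \<in> ?I" "real (card V) * ln D / 8 \<le> 2 * D * real (card W)" by blast
  moreover from this D have "ln D / (16 * D) * real (card V) \<le> real (card W)"
    by (simp add: field_simps)
  ultimately show ?thesis using that by auto
qed

section \<open>Colour classes with little internal weight\<close>

text \<open>A uniformly random \<open>r\<close>-colouring made deterministic: each new vertex joins
  a class whose weight towards it is at most the average. Sums run over ordered pairs, hence the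
  factor 2 in the induction step.\<close>

lemma balanced_colouring:
  fixes w :: "'a \<Rightarrow> 'a \<Rightarrow> real"
  assumes "finite V" "1 \<le> r" "\<And>u v. w u v = w v u" "\<And>u. w u u = 0"
  shows "\<exists>f :: 'a \<Rightarrow> nat. (\<forall>v. f v < r) \<and>
    (\<Sum>u\<in>V. \<Sum>v\<in>V. if f u = f v then w u v else 0) \<le> (\<Sum>u\<in>V. \<Sum>v\<in>V. w u v) / real r"
  using assms(1)
proof (induction V rule: finite_induct)
  case empty
  show ?case using assms(2) by (intro exI[of _ "\<lambda>_. 0"]) simp
next
  case (insert a V)
  then obtain f :: "'a \<Rightarrow> nat" where f: "\<And>v. f v < r"
    and le: "(\<Sum>u\<in>V. \<Sum>v\<in>V. if f u = f v then w u v else 0) \<le> (\<Sum>u\<in>V. \<Sum>v\<in>V. w u v) / real r"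
    by blast
  define g where "g c = (\<Sum>v\<in>V. if f v = c then w a v else 0)" for c
  have "(\<Sum>c<r. g c) = (\<Sum>v\<in>V. \<Sum>c<r. if f v = c then w a v else 0)"
    unfolding g_def by (rule sum.swap)
  also have "\<dots> = (\<Sum>v\<in>V. w a v)" using f by (intro sum.cong) auto
  finally have gs: "(\<Sum>c<r. g c) = (\<Sum>v\<in>V. w a v)" .
  have "\<exists>c<r. g c \<le> (\<Sum>v\<in>V. w a v) / real r"
  proof (rule ccontr)
    assume "\<not> ?thesis"
    then have "(\<Sum>c<r. (\<Sum>v\<in>V. w a v) / real r) < (\<Sum>c<r. g c)"
      using assms(2) by (intro sum_strict_mono) (auto simp: not_le lessThan_empty_iff)
    with gs assms(2) show False by simp
  qed
  then obtain c where c: "c < r" "g c \<le> (\<Sum>v\<in>V. w a v) / real r" by blast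
  let ?f = "f(a := c)"
  have ne: "v \<noteq> a" if "v \<in> V" for v using that insert.hyps by auto
  have 1: "(\<Sum>v\<in>V. if ?f a = ?f v then w a v else 0) = g c"
    unfolding g_def using ne by (intro sum.cong) auto
  have 2: "(\<Sum>u\<in>V. if ?f u = ?f a then w u a else 0) = g c"
    unfolding g_def using ne assms(3)[of _ a] by (intro sum.cong) auto
  have 3: "(\<Sum>u\<in>V. \<Sum>v\<in>V. if ?f u = ?f v then w u v else 0) = (\<Sum>u\<in>V. \<Sum>v\<in>V. if f u = f v then w u v else 0)"
    using ne by (intro sum.cong) auto
  have "(\<Sum>u\<in>insert a V. \<Sum>v\<in>insert a V. if ?f u = ?f v then w u v else 0)
      = 2 * g c + (\<Sum>u\<in>V. \<Sum>v\<in>V. if f u = f v then w u v else 0)"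
    using insert.hyps assms(4) 1 2 3 by (simp add: sum.distrib del: fun_upd_apply)
  also have "\<dots> \<le> (2 * (\<Sum>v\<in>V. w a v) + (\<Sum>u\<in>V. \<Sum>v\<in>V. w u v)) / real r"
    using le c by (simp add: add_divide_distrib)
  also have "2 * (\<Sum>v\<in>V. w a v) + (\<Sum>u\<in>V. \<Sum>v\<in>V. w u v) = (\<Sum>u\<in>insert a V. \<Sum>v\<in>insert a V. w u v)"
    using insert.hyps assms(4) assms(3)[of _ a] by (simp add: sum.distrib)
  finally show ?case using f c by (intro exI[of _ ?f]) auto
qed

text \<open>Averaging over the classes: their sizes sum to \<open>card V\<close> and their internal
  weights to at most the total weight divided by \<open>r\<close>, so some class attains the mean
  surplus.\<close>

lemma light_colour_class:
  fixes w :: "'a \<Rightarrow> 'a \<Rightarrow> real"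
  assumes "finite V" "1 \<le> r" "\<And>u v. w u v = w v u" "\<And>u. w u u = 0"
  obtains Q where "Q \<subseteq> V"
    "(real (card V) - (\<Sum>u\<in>V. \<Sum>v\<in>V. w u v) / real r) / real r \<le> real (card Q) - (\<Sum>u\<in>Q. \<Sum>v\<in>Q. w u v)"
proof -
  obtain f :: "'a \<Rightarrow> nat" where f: "\<And>v. f v < r"
    and le: "(\<Sum>u\<in>V. \<Sum>v\<in>V. if f u = f v then w u v else 0) \<le> (\<Sum>u\<in>V. \<Sum>v\<in>V. w u v) / real r"
    using balanced_colouring[of V r w] assms by blast
  let ?Q = "\<lambda>c. {v \<in> V. f v = c}"
  let ?R = "(real (card V) - (\<Sum>u\<in>V. \<Sum>v\<in>V. w u v) / real r) / real r"
  have img: "f ` V \<subseteq> {..<r}" using f by auto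
  have "(\<Sum>c<r. \<Sum>u\<in>?Q c. \<Sum>v\<in>?Q c. w u v) = (\<Sum>c<r. \<Sum>u\<in>?Q c. \<Sum>v\<in>V. if f u = f v then w u v else 0)"
  proof (rule sum.cong[OF refl], rule sum.cong[OF refl])
    fix c u assume "c \<in> {..<r}" "u \<in> ?Q c"
    then have "?Q c = {v \<in> V. f u = f v}" by auto
    then show "(\<Sum>v\<in>?Q c. w u v) = (\<Sum>v\<in>V. if f u = f v then w u v else 0)"
      using sum.inter_filter[OF assms(1)] by simp
  qed
  also have "\<dots> = (\<Sum>u\<in>V. \<Sum>v\<in>V. if f u = f v then w u v else 0)"
    by (rule sum.group[OF assms(1) _ img]) simp
  finally have 1: "(\<Sum>c<r. \<Sum>u\<in>?Q c. \<Sum>v\<in>?Q c. w u v) \<le> (\<Sum>u\<in>V. \<Sum>v\<in>V. w u v) / real r" using le by simp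
  have 2: "(\<Sum>c<r. real (card (?Q c))) = real (card V)"
    using sum.group[OF assms(1) _ img, of "\<lambda>_. 1::real"] by simp
  have "\<exists>c<r. ?R \<le> real (card (?Q c)) - (\<Sum>u\<in>?Q c. \<Sum>v\<in>?Q c. w u v)"
  proof (rule ccontr)
    assume "\<not> ?thesis"
    then have "(\<Sum>c<r. real (card (?Q c)) - (\<Sum>u\<in>?Q c. \<Sum>v\<in>?Q c. w u v)) < (\<Sum>c<r. ?R)"
      using assms(2) by (intro sum_strict_mono) (auto simp: not_le lessThan_empty_iff)
    also have "\<dots> = real (card V) - (\<Sum>u\<in>V. \<Sum>v\<in>V. w u v) / real r" using assms(2) by simp
    finally show False using 1 2 by (simp only: sum_subtractf)
  qed
  then show ?thesis using that[of "?Q _"] by auto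
qed

text \<open>Markov's inequality for counting; it bounds the number of vertices of large
  degree.\<close>

lemma card_exceeding_le:
  fixes g :: "'a \<Rightarrow> real"
  assumes "finite Q" "0 < D" "\<And>u. u \<in> Q \<Longrightarrow> 0 \<le> g u"
  shows "real (card {u \<in> Q. D \<le> g u}) \<le> sum g Q / D"
proof -
  have "D * real (card {u \<in> Q. D \<le> g u}) = (\<Sum>u\<in>{u \<in> Q. D \<le> g u}. D)" by simp
  also have "\<dots> \<le> (\<Sum>u\<in>{u \<in> Q. D \<le> g u}. g u)" by (rule sum_mono) simp
  also have "\<dots> \<le> sum g Q" using assms by (intro sum_mono2) auto
  finally show ?thesis using assms(2) by (simp add: field_simps)
qed

text \<open>Pass to a colour class of a balanced \<^term>\<open>r\<close>-colouring: there the few pairs in \<^term>\<open>X\<close> that destroy all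
  triangles can be removed together with the vertices of large degree.\<close>

lemma nearly_triangle_free_indep_set:
  fixes E X :: "'a \<Rightarrow> 'a \<Rightarrow> bool" and D :: real
  assumes fin: "finite V" and sym: "\<And>u w. E u w \<Longrightarrow> E w u" and irr: "\<And>u. \<not> E u u"
    and symX: "\<And>u w. X u w \<Longrightarrow> X w u" and irrX: "\<And>u. \<not> X u u"
    and tri: "\<And>a b c. a \<in> V \<Longrightarrow> b \<in> V \<Longrightarrow> c \<in> V \<Longrightarrow> E a b \<Longrightarrow> E a c \<Longrightarrow> E b c \<Longrightarrow> X a b \<or> X a c \<or> X b c"
    and D: "1 \<le> D" and r: "1 \<le> r"
    and few: "real (card {(u, v). u \<in> V \<and> v \<in> V \<and> X u v}) + real (card {(u, v). u \<in> V \<and> v \<in> V \<and> E u v}) / D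
      \<le> real r * real (card V) / 2"
  obtains W where "W \<subseteq> V" "\<forall>u\<in>W. \<forall>w\<in>W. \<not> E u w" "ln D / (32 * D * real r) * real (card V) \<le> real (card W)"
proof -
  \<comment> \<open>The weight inside a class bounds the number of deletions: at most one per
    ordered pair in \<open>X\<close>, and by Markov at most \<open>1 / D\<close> per ordered
    adjacent pair for the vertices of degree at least \<open>D\<close>.\<close>
  define w where "w u v = (if X u v then 1 else 0) + (if E u v then 1 / D else 0)" for u v
  have cnt: "(\<Sum>u\<in>Q. \<Sum>v\<in>Q. if Y u v then k else 0) = real (card {(u, v). u \<in> Q \<and> v \<in> Q \<and> Y u v}) * k"
    if "finite Q" for Q and Y :: "'a \<Rightarrow> 'a \<Rightarrow> bool" and k :: real
  proof -
    have "(\<Sum>u\<in>Q. \<Sum>v\<in>Q. if Y u v then k else 0) = (\<Sum>z\<in>Q \<times> Q. if Y (fst z) (snd z) then k else 0)"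
      by (simp add: sum.cartesian_product case_prod_beta)
    also have "\<dots> = (\<Sum>z\<in>{z \<in> Q \<times> Q. Y (fst z) (snd z)}. k)"
      using that by (intro sum.inter_filter[symmetric]) simp
    also have "{z \<in> Q \<times> Q. Y (fst z) (snd z)} = {(u, v). u \<in> Q \<and> v \<in> Q \<and> Y u v}" by auto
    finally show ?thesis by simp
  qed
  have "(\<Sum>u\<in>V. \<Sum>v\<in>V. w u v) = real (card {(u, v). u \<in> V \<and> v \<in> V \<and> X u v})
      + real (card {(u, v). u \<in> V \<and> v \<in> V \<and> E u v}) / D"
    unfolding w_def sum.distrib cnt[OF fin] by simp
  with few have wle: "(\<Sum>u\<in>V. \<Sum>v\<in>V. w u v) / real r \<le> real (card V) / 2"
    using r by (simp add: field_simps)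
  have wsym: "w u v = w v u" for u v using sym symX by (auto simp: w_def)
  have wirr: "w u u = 0" for u using irr irrX by (auto simp: w_def)
  obtain Q where Q: "Q \<subseteq> V"
    "(real (card V) - (\<Sum>u\<in>V. \<Sum>v\<in>V. w u v) / real r) / real r \<le> real (card Q) - (\<Sum>u\<in>Q. \<Sum>v\<in>Q. w u v)"
    by (rule light_colour_class[OF fin r wsym wirr])
  have finQ: "finite Q" using Q fin finite_subset by blast
  define A where "A = {u \<in> Q. \<exists>v\<in>Q. X u v}"
  define B where "B = {u \<in> Q. D \<le> real (card {v \<in> Q. E u v})}"
  define V' where "V' = Q - A - B"
  have finAB: "finite A" "finite B" "finite V'" using finQ by (auto simp: A_def B_def V'_def)
  have "A \<subseteq> fst ` {(u, v). u \<in> Q \<and> v \<in> Q \<and> X u v}" unfolding A_def by force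
  moreover have "finite {(u, v). u \<in> Q \<and> v \<in> Q \<and> X u v}"
    by (rule finite_subset[of _ "Q \<times> Q"]) (use finQ in auto)
  ultimately have "card A \<le> card {(u, v). u \<in> Q \<and> v \<in> Q \<and> X u v}"
    using surj_card_le by blast
  then have Ale: "real (card A) \<le> (\<Sum>u\<in>Q. \<Sum>v\<in>Q. if X u v then 1 else 0)"
    unfolding cnt[OF finQ] by simp
  have "real (card B) \<le> (\<Sum>u\<in>Q. real (card {v \<in> Q. E u v})) / D"
    unfolding B_def using D finQ by (intro card_exceeding_le) auto
  also have "\<dots> = (\<Sum>u\<in>Q. \<Sum>v\<in>Q. if E u v then 1 / D else 0)"
    using finQ by (simp add: sum.inter_filter[symmetric] sum_divide_distrib)
  finally have Ble: "real (card B) \<le> (\<Sum>u\<in>Q. \<Sum>v\<in>Q. if E u v then 1 / D else 0)" .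
  have "card Q \<le> card (V' \<union> (A \<union> B))"
    using finAB by (intro card_mono) (auto simp: V'_def)
  also have "\<dots> \<le> card V' + (card A + card B)"
    using card_Un_le[of V' "A \<union> B"] card_Un_le[of A B] by linarith
  finally have "real (card Q) - (\<Sum>u\<in>Q. \<Sum>v\<in>Q. w u v) \<le> real (card V')"
    using Ale Ble unfolding w_def sum.distrib by linarith
  \<comment> \<open>By \<open>wle\<close> the deletions leave at least half of the average class
    size \<open>card V / r\<close>.\<close>
  moreover have "real (card V) / (2 * real r) \<le> (real (card V) - (\<Sum>u\<in>V. \<Sum>v\<in>V. w u v) / real r) / real r"
    using wle r by (simp add: field_simps)
  ultimately have V'large: "real (card V) / (2 * real r) \<le> real (card V')" using Q(2) by linarith
  have sub: "V' \<subseteq> Q" "V' \<subseteq> V" using Q by (auto simp: V'_def)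
  have noX: "\<not> X a b" if "a \<in> V'" "b \<in> V'" for a b
    using that by (auto simp: V'_def A_def)
  have deg: "real (card {u \<in> V'. E v u}) \<le> D" if "v \<in> V'" for v
  proof -
    have "card {u \<in> V'. E v u} \<le> card {u \<in> Q. E v u}"
      using finQ sub by (intro card_mono) auto
    with that show ?thesis by (auto simp: V'_def B_def)
  qed
  have tri': "\<not> E b c" if "a \<in> V'" "b \<in> V'" "c \<in> V'" "E a b" "E a c" for a b c
    using tri[of a b c] noX that sub by blast
  obtain W where W: "W \<subseteq> V'" "\<forall>u\<in>W. \<forall>w\<in>W. \<not> E u w" "ln D / (16 * D) * real (card V') \<le> real (card W)"
    by (rule triangle_free_indep_set[OF finAB(3) sym irr tri' deg D])
  have "ln D / (32 * D * real r) * real (card V) = ln D / (16 * D) * (real (card V) / (2 * real r))"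
    using D r by (simp add: field_simps)
  also have "\<dots> \<le> ln D / (16 * D) * real (card V')"
    using V'large D by (intro mult_left_mono) auto
  also note W(3)
  finally show ?thesis using that[of W] W sub by auto
qed

section \<open>Pairs and edge-disjoint triangles\<close>

definition pairs :: "'a set \<Rightarrow> 'a set set" where
  "pairs V = {e. e \<subseteq> V \<and> card e = 2}"

lemma finite_pairs: "finite V \<Longrightarrow> finite (pairs V)"
  unfolding pairs_def by simp

lemma card_pairs: "finite V \<Longrightarrow> card (pairs V) = card V choose 2"
  unfolding pairs_def by (rule n_subsets)

lemma pairs_mono: "U \<subseteq> V \<Longrightarrow> pairs U \<subseteq> pairs V"
  unfolding pairs_def by auto

lemma pair_in_pairs: "{u, v} \<in> pairs V \<longleftrightarrow> u \<in> V \<and> v \<in> V \<and> u \<noteq> v"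
  unfolding pairs_def by (cases "u = v") auto

text \<open>Bridge between edges as unordered pairs, which the random graph counts, and the ordered
  pairs of the colouring estimates; an edge has two orientations.\<close>

lemma card_ordered_pairs:
  assumes "finite V" "X \<subseteq> pairs V"
  shows "card {(u, v). u \<in> V \<and> v \<in> V \<and> {u, v} \<in> X} \<le> 2 * card X"
proof -
  have finX: "finite X" using assms finite_pairs finite_subset by blast
  have 2: "card {(u, v). {u, v} = e} \<le> 2" if "e \<in> X" for e
  proof -
    have "card e = 2" using that assms(2) by (auto simp: pairs_def)
    then obtain a b where "e = {a, b}" by (auto simp: card_2_iff)
    then have "{(u, v). {u, v} = e} \<subseteq> {(a, b), (b, a)}" by (auto simp: doubleton_eq_iff)
    moreover have "finite {(a, b), (b, a)}" "card {(a, b), (b, a)} \<le> 2"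
      by (cases "a = b"; simp)+
    ultimately show ?thesis using card_mono order_trans by blast
  qed
  have "u \<in> V \<and> v \<in> V" if "{u, v} \<in> X" for u v
    using that assms(2) pair_in_pairs[of u v V] by blast
  then have "{(u, v). u \<in> V \<and> v \<in> V \<and> {u, v} \<in> X} = (\<Union>e\<in>X. {(u, v). {u, v} = e})" by auto
  then have "card {(u, v). u \<in> V \<and> v \<in> V \<and> {u, v} \<in> X} \<le> (\<Sum>e\<in>X. card {(u, v). {u, v} = e})"
    using card_UN_le[OF finX] by simp
  also have "\<dots> \<le> (\<Sum>e\<in>X. 2)" using 2 by (rule sum_mono)
  finally show ?thesis by simp
qed

text \<open>A family of edge-disjoint triangles, \<open>pairs \<tau>\<close> being the edge set of
  the triangle on \<open>\<tau>\<close>. Edge-disjointness makes the presence of these triangles in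
  a random graph independent.\<close>

definition packing :: "'a set \<Rightarrow> 'a set set \<Rightarrow> bool" where
  "packing V P \<longleftrightarrow> (\<forall>\<tau>\<in>P. \<tau> \<subseteq> V \<and> card \<tau> = 3) \<and> disjoint_family_on pairs P"

lemma packing_subset: "packing V P \<Longrightarrow> P' \<subseteq> P \<Longrightarrow> packing V P'"
  unfolding packing_def disjoint_family_on_def by blast

lemma packing_Pow: "packing V P \<Longrightarrow> P \<subseteq> Pow V"
  unfolding packing_def by auto

lemma card_pairs_packing:
  assumes "finite V" "packing V P" shows "card (\<Union> (pairs ` P)) = 3 * card P"
proof -
  have finP: "finite P" using packing_Pow[OF assms(2)] assms(1) by (auto intro: finite_subset)
  have "card (\<Union> (pairs ` P)) = (\<Sum>\<tau>\<in>P. card (pairs \<tau>))"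
    using assms finP unfolding packing_def disjoint_family_on_def
    by (intro card_UN_disjoint) (auto intro: finite_pairs finite_subset)
  also have "\<dots> = (\<Sum>\<tau>\<in>P. 3)"
  proof (rule sum.cong)
    fix \<tau> assume "\<tau> \<in> P"
    then have "card \<tau> = 3" using assms by (auto simp: packing_def)
    then have "card (pairs \<tau>) = 3 choose 2" using card_pairs[of \<tau>] card.infinite[of \<tau>] by fastforce
    then show "card (pairs \<tau>) = 3" by (simp add: choose_two)
  qed simp
  finally show ?thesis by simp
qed

text \<open>The edges of an inclusion-maximal packing inside \<open>F\<close> meet every triangle of
  \<open>F\<close>, since a missed one could be added. More than \<open>M\<close> members are
  impossible because a subfamily of size exactly \<open>M\<close> would again be a packing inside
  \<open>F\<close>.\<close>

lemma maximal_packing_hits_triangles: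
  assumes fin: "finite V" and F: "F \<subseteq> pairs V"
    and no: "\<And>P. packing V P \<Longrightarrow> \<Union> (pairs ` P) \<subseteq> F \<Longrightarrow> card P \<noteq> M"
  obtains X where "X \<subseteq> F" "card X \<le> 3 * M"
    "\<And>a b c. {a, b} \<in> F \<Longrightarrow> {a, c} \<in> F \<Longrightarrow> {b, c} \<in> F \<Longrightarrow> {a, b} \<in> X \<or> {a, c} \<in> X \<or> {b, c} \<in> X"
proof -
  let ?good = "\<lambda>P. packing V P \<and> \<Union> (pairs ` P) \<subseteq> F"
  have good0: "?good {}" by (simp add: packing_def disjoint_family_on_def)
  have finG: "finite {P. ?good P}"
    by (rule finite_subset[of _ "Pow (Pow V)"]) (use fin packing_Pow in auto)
  obtain P where P: "?good P" and max: "\<And>P'. ?good P' \<Longrightarrow> P \<subseteq> P' \<Longrightarrow> P' = P"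
    using finite_has_maximal[OF finG] good0 by (metis (mono_tags, lifting) empty_iff mem_Collect_eq)
  have finP: "finite P" using P packing_Pow fin by (meson finite_Pow_iff finite_subset)
  have "card P \<le> M"
  proof (rule ccontr)
    assume "\<not> card P \<le> M"
    then obtain P' where P': "P' \<subseteq> P" "card P' = M"
      using obtain_subset_with_card_n[of M P] by auto
    then have "?good P'" using P packing_subset by blast
    with no P' show False by blast
  qed
  show ?thesis
  proof (rule that)
    show "\<Union> (pairs ` P) \<subseteq> F" using P by simp
    show "card (\<Union> (pairs ` P)) \<le> 3 * M" using card_pairs_packing[OF fin] P \<open>card P \<le> M\<close> by simp
    fix a b c assume abc: "{a, b} \<in> F" "{a, c} \<in> F" "{b, c} \<in> F"
    let ?t = "{a, b, c}"
    have V: "a \<in> V" "b \<in> V" "c \<in> V" "a \<noteq> b" "a \<noteq> c" "b \<noteq> c"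
      using abc F pair_in_pairs by (metis subsetD)+
    have pt: "pairs ?t = {{a, b}, {a, c}, {b, c}}"
    proof (intro equalityI subsetI)
      fix e assume e: "e \<in> pairs ?t"
      then have "card e = 2" by (auto simp: pairs_def)
      then obtain x y where xy: "e = {x, y}" "x \<noteq> y" by (auto simp: card_2_iff)
      with e have "x \<in> ?t" "y \<in> ?t" using pair_in_pairs[of x y ?t] by auto
      with xy show "e \<in> {{a, b}, {a, c}, {b, c}}" by (auto simp: insert_commute)
    qed (use V in \<open>auto simp: pairs_def\<close>)
    show "{a, b} \<in> \<Union> (pairs ` P) \<or> {a, c} \<in> \<Union> (pairs ` P) \<or> {b, c} \<in> \<Union> (pairs ` P)"
    proof (rule ccontr)
      assume non: "\<not> ?thesis"
      have disj: "pairs ?t \<inter> pairs \<tau> = {}" if "\<tau> \<in> P" for \<tau> using non that unfolding pt by auto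
      have "disjoint_family_on pairs (insert ?t P)"
        using P disj unfolding packing_def disjoint_family_on_def by (metis Int_commute insertE)
      then have "?good (insert ?t P)" using P V abc pt by (auto simp: packing_def)
      then have "?t \<in> P" using max[of "insert ?t P"] by blast
      with disj[of ?t] show False unfolding pt by simp
    qed
  qed
qed

section \<open>Random graphs\<close>

definition graph_of :: "'a set set \<Rightarrow> 'a \<Rightarrow> 'a \<Rightarrow> bool" where
  "graph_of F u v \<longleftrightarrow> {u, v} \<in> F"

lemma graph_on_graph_of:
  assumes "F \<subseteq> pairs {..<n}" shows "graph_on n (graph_of F)"
proof -
  have "u < n \<and> v < n \<and> u \<noteq> v" if "{u, v} \<in> F" for u v
    using that assms pair_in_pairs[of u v "{..<n}"] by auto
  then show ?thesis unfolding graph_on_def graph_of_def by (metis insert_commute)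
qed

lemma graph_of_sym: "graph_of F u v \<Longrightarrow> graph_of F v u"
  by (simp add: graph_of_def insert_commute)

lemma graph_of_irrefl: "F \<subseteq> pairs V \<Longrightarrow> \<not> graph_of F u u"
  using pair_in_pairs[of u u V] by (auto simp: graph_of_def)

lemma independent_iff:
  assumes "F \<subseteq> pairs V"
  shows "(\<forall>u\<in>S. \<forall>v\<in>S. \<not> graph_of F u v) \<longleftrightarrow> F \<inter> pairs S = {}"
proof
  assume L: "\<forall>u\<in>S. \<forall>v\<in>S. \<not> graph_of F u v"
  have False if e: "e \<in> F" "e \<in> pairs S" for e
  proof -
    from e(2) have "card e = 2" by (auto simp: pairs_def)
    then obtain u v where uv: "e = {u, v}" by (auto simp: card_2_iff)
    with e(2) have "u \<in> S" "v \<in> S" using pair_in_pairs[of u v S] by auto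
    with L e uv show False by (auto simp: graph_of_def)
  qed
  then show "F \<inter> pairs S = {}" by blast
next
  assume R: "F \<inter> pairs S = {}"
  show "\<forall>u\<in>S. \<forall>v\<in>S. \<not> graph_of F u v"
  proof (intro ballI notI)
    fix u v assume uv: "u \<in> S" "v \<in> S" "graph_of F u v"
    then have "u \<noteq> v" using graph_of_irrefl[OF assms] by auto
    with uv R show False using pair_in_pairs[of u v S] by (auto simp: graph_of_def)
  qed
qed

lemma indep_set_graph_of:
  "F \<subseteq> pairs V \<Longrightarrow> indep_set (graph_of F) S \<longleftrightarrow> F \<inter> pairs S = {}"
  unfolding indep_set_def by (rule independent_iff)

text \<open>Independence passes to subsets, so excluding the single size \<open>k\<close> excludes
  all larger sizes.\<close>

lemma alpha_less:
  assumes "\<And>S. S \<subseteq> {..<n} \<Longrightarrow> card S = k \<Longrightarrow> \<not> indep_set E S"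
  shows "alpha n E < k"
proof -
  let ?A = "{card S | S. S \<subseteq> {..<n} \<and> indep_set E S}"
  have "?A = card ` {S. S \<subseteq> {..<n} \<and> indep_set E S}" by auto
  then have fin: "finite ?A" by simp
  have "indep_set E {}" by (simp add: indep_set_def)
  then have ne: "?A \<noteq> {}" by blast
  from Max_in[OF fin ne] obtain S where S: "S \<subseteq> {..<n}" "indep_set E S" "alpha n E = card S"
    unfolding alpha_def by blast
  show ?thesis
  proof (rule ccontr)
    assume "\<not> ?thesis"
    with S(3) have "k \<le> card S" by simp
    then obtain T where T: "T \<subseteq> S" "card T = k" using obtain_subset_with_card_n by blast
    then have "indep_set E T" using S(2) unfolding indep_set_def by blast
    with assms T S show False by blast
  qed
qed

text \<open>The single term \<open>k ^ k / fact k\<close> of the exponential series is at most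
  \<open>exp k\<close>.\<close>

lemma binomial_le_exp_pow: "real (N choose k) \<le> (exp 1 * real N / real k) ^ k"
proof (cases "k = 0")
  case False
  have "real k ^ k / fact k \<le> (\<Sum>n. real k ^ n /\<^sub>R fact n)"
    using sum_le_suminf[OF summable_exp_generic[of "real k"], of "{k}"]
    by (simp add: divide_inverse mult.commute)
  then have 1: "real k ^ k \<le> exp (real k) * fact k"
    by (simp add: exp_def field_simps)
  have "real ((N choose k) * fact k) \<le> real (N ^ k)"
    using binomial_fact_pow of_nat_le_iff by blast
  then have "real (N choose k) * fact k \<le> real N ^ k" by simp
  then have "real (N choose k) * (real k ^ k) \<le> exp (real k) * real N ^ k"
    using 1 by (smt (verit, best) exp_gt_zero mult.assoc mult.commute mult_left_mono of_nat_0_le_iff)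
  moreover have "exp (real k) = exp 1 ^ k" by (simp add: exp_of_nat_mult[symmetric])
  ultimately show ?thesis using False
    by (simp add: power_divide power_mult_distrib field_simps)
qed simp

lemma binomial_le_power: "real (N choose k) \<le> real N ^ k"
proof -
  have "(N choose k) * 1 \<le> (N choose k) * fact k" by (intro mult_le_mono2) (simp add: Suc_leI)
  also have "\<dots> \<le> N ^ k" by (rule binomial_fact_pow)
  finally have "real (N choose k) \<le> real (N ^ k)" using of_nat_le_iff by simp
  then show ?thesis by simp
qed

lemma pr_large_indep:
  assumes p: "0 \<le> p" "p \<le> 1"
  shows "pr p (pairs {..<n}) (\<lambda>F. \<exists>S\<in>{S. S \<subseteq> {..<n} \<and> card S = k}. F \<inter> pairs S = {})
    \<le> real (n choose k) * (1 - p) ^ (k choose 2)"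
proof -
  have "pr p (pairs {..<n}) (\<lambda>F. \<exists>S\<in>{S. S \<subseteq> {..<n} \<and> card S = k}. F \<inter> pairs S = {})
      \<le> real (card {S. S \<subseteq> {..<n} \<and> card S = k}) * (1 - p) ^ (k choose 2)"
  proof (rule pr_union_bound[OF finite_pairs p])
    fix S assume "S \<in> {S. S \<subseteq> {..<n} \<and> card S = k}"
    then have S: "S \<subseteq> {..<n}" "finite S" "card S = k" using finite_subset by auto
    show "pr p (pairs {..<n}) (\<lambda>F. F \<inter> pairs S = {}) \<le> (1 - p) ^ (k choose 2)"
      using pr_avoid[OF finite_pairs pairs_mono[OF S(1)], of p] S card_pairs[OF S(2)] by simp
  qed auto
  then show ?thesis by (simp add: n_subsets)
qed

lemma one_minus_power_le_exp:
  fixes p :: real assumes "0 \<le> p" "p \<le> 1" shows "(1 - p) ^ m \<le> exp (- (p * real m))"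
proof -
  have "(1 - p) ^ m \<le> exp (- p) ^ m" using assms exp_ge_add_one_self[of "- p"] by (intro power_mono) auto
  also have "\<dots> = exp (- (p * real m))" by (simp add: exp_of_nat_mult[symmetric] mult.commute)
  finally show ?thesis .
qed

section \<open>Greedy colouring by maximal independent sets\<close>

text \<open>Colour \<open>j < k\<close> marks the maximal independent set removed in round
  \<open>j\<close>, and colour \<open>k\<close> collects what is left. By maximality every vertex
  surviving round \<open>j\<close> has a neighbour in class \<open>j\<close>.\<close>

lemma greedy_colouring:
  fixes E :: "'a \<Rightarrow> 'a \<Rightarrow> bool"
  assumes "finite S" "\<And>u v. E u v \<Longrightarrow> E v u" "\<And>u. \<not> E u u"
    "\<And>I. I \<subseteq> S \<Longrightarrow> (\<forall>u\<in>I. \<forall>v\<in>I. \<not> E u v) \<Longrightarrow> card I \<le> t"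
  shows "\<exists>f :: 'a \<Rightarrow> nat. (\<forall>v. f v \<le> k) \<and> (\<forall>j<k. card {v \<in> S. f v = j} \<le> t) \<and>
    (\<forall>j<k. \<forall>v\<in>S. j < f v \<longrightarrow> (\<exists>i\<in>S. f i = j \<and> E v i))"
  using assms(1,4)
proof (induction k arbitrary: S)
  case 0
  show ?case by (intro exI[of _ "\<lambda>_. 0"]) simp
next
  case (Suc k)
  let ?G = "{I. I \<subseteq> S \<and> (\<forall>u\<in>I. \<forall>v\<in>I. \<not> E u v)}"
  have finG: "finite ?G" using Suc.prems(1) by simp
  have "{} \<in> ?G" by simp
  then obtain I where I: "I \<in> ?G" and max: "\<And>J. J \<in> ?G \<Longrightarrow> I \<subseteq> J \<Longrightarrow> J = I"
    using finite_has_maximal[OF finG] by (metis (no_types, lifting) empty_iff)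
  have nbr: "\<exists>i\<in>I. E v i" if "v \<in> S" "v \<notin> I" for v
  proof (rule ccontr)
    assume no: "\<not> ?thesis"
    have "\<not> E a b" if "a \<in> insert v I" "b \<in> insert v I" for a b
      using that no I assms(2)[of a b] assms(3)[of v] by auto
    then have "insert v I \<in> ?G" using I \<open>v \<in> S\<close> by simp
    with max[of "insert v I"] \<open>v \<notin> I\<close> show False by blast
  qed
  have prem: "card J \<le> t" if "J \<subseteq> S - I" "\<forall>u\<in>J. \<forall>v\<in>J. \<not> E u v" for J
    using Suc.prems(2)[of J] that by auto
  have "\<exists>g :: 'a \<Rightarrow> nat. (\<forall>v. g v \<le> k) \<and> (\<forall>j<k. card {v \<in> S - I. g v = j} \<le> t) \<and>
    (\<forall>j<k. \<forall>v\<in>S - I. j < g v \<longrightarrow> (\<exists>i\<in>S - I. g i = j \<and> E v i))"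
    by (rule Suc.IH) (use Suc.prems(1) prem in auto)
  then obtain g :: "'a \<Rightarrow> nat" where g: "\<forall>v. g v \<le> k" "\<forall>j<k. card {v \<in> S - I. g v = j} \<le> t"
    "\<forall>j<k. \<forall>v\<in>S - I. j < g v \<longrightarrow> (\<exists>i\<in>S - I. g i = j \<and> E v i)"
    by (elim exE conjE)
  \<comment> \<open>The first round removes \<open>I\<close>; the colours of the remaining set move
    up by one.\<close>
  define f where "f v = (if v \<in> I then 0 else Suc (g v))" for v
  have f0: "{v \<in> S. f v = 0} = I" using I by (auto simp: f_def)
  have fS: "{v \<in> S. f v = Suc j} = {v \<in> S - I. g v = j}" for j by (auto simp: f_def)
  have "card {v \<in> S. f v = j} \<le> t" if "j < Suc k" for j
    using that g(2) Suc.prems(2)[of I] I f0 fS by (cases j) auto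
  moreover have "\<exists>i\<in>S. f i = j \<and> E v i" if j: "j < Suc k" and v: "v \<in> S" "j < f v" for j v
  proof -
    have vI: "v \<notin> I" using v(2) by (auto simp: f_def split: if_splits)
    show ?thesis
    proof (cases j)
      case 0
      then show ?thesis using nbr[OF v(1) vI] I by (auto simp: f_def)
    next
      case (Suc j')
      then have "j' < k" "v \<in> S - I" "j' < g v" using j v vI by (auto simp: f_def)
      then have "\<exists>i\<in>S - I. g i = j' \<and> E v i" using g(3) by blast
      then show ?thesis using Suc by (auto simp: f_def)
    qed
  qed
  moreover have "f v \<le> Suc k" for v using g(1) by (simp add: f_def)
  ultimately show ?case by blast
qed

text \<open>The pairs joining a vertex \<^term>\<open>v\<close> to the colour classes below its own are pairwise disjoint, so the
  events that all of them contain an edge are independent.\<close>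

lemma pr_greedy_colouring:
  fixes f :: "'a \<Rightarrow> nat"
  assumes p: "0 \<le> p" "p \<le> 1" and V: "finite V" "S \<subseteq> V" and kt: "2 * k * t \<le> card S"
    and cls: "\<And>j. j < k \<Longrightarrow> card {v \<in> S. f v = j} \<le> t"
  shows "pr p (pairs V) (\<lambda>F. \<forall>j<k. \<forall>v\<in>S. j < f v \<longrightarrow> (\<exists>i\<in>S. f i = j \<and> graph_of F v i))
    \<le> exp (- (real k * real (card S) / 2 * (1 - p) ^ t))"
proof -
  \<comment> \<open>\<open>K\<close> indexes the events by a round \<open>j\<close> and a vertex
    \<open>v\<close> surviving it; \<open>T (j, v)\<close> holds the pairs from \<open>v\<close> to
    class \<open>j\<close>.\<close>
  define K where "K = (SIGMA j:{..<k}. {v \<in> S. j < f v})"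
  define T where "T = (\<lambda>(j, v). (\<lambda>i. {v, i}) ` {i \<in> S. f i = j})"
  have finS: "finite S" using V finite_subset by blast
  have finK: "finite K" using finS by (auto simp: K_def)
  have TU: "T z \<subseteq> pairs V" if "z \<in> K" for z
    using that V by (auto simp: K_def T_def pair_in_pairs)
  \<comment> \<open>A pair \<open>{v, i}\<close> in \<open>T (j, v)\<close> has
    \<open>f i = j < f v\<close>, so its colours determine both \<open>v\<close> and
    \<open>j\<close>.\<close>
  have dis: "disjoint_family_on T K"
    unfolding disjoint_family_on_def
  proof (intro ballI impI)
    fix z z' assume z: "z \<in> K" "z' \<in> K" "z \<noteq> z'"
    obtain j v j' v' where [simp]: "z = (j, v)" "z' = (j', v')" by (cases z, cases z')
    show "T z \<inter> T z' = {}"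
      using z by (auto simp: T_def K_def doubleton_eq_iff)
  qed
  have cT: "card (T (j, v)) \<le> t" if "(j, v) \<in> K" for j v
  proof -
    have "card (T (j, v)) \<le> card {i \<in> S. f i = j}"
      unfolding T_def using finS by (simp add: card_image_le)
    also have "\<dots> \<le> t" using that cls by (auto simp: K_def)
    finally show ?thesis .
  qed
  \<comment> \<open>The classes up to \<open>j\<close> hold at most \<open>k * t\<close> vertices,
    which is at most half of \<open>S\<close>.\<close>
  have big: "real (card S) / 2 \<le> real (card {v \<in> S. j < f v})" if j: "j < k" for j
  proof -
    have "S = {v \<in> S. j < f v} \<union> (\<Union>i\<in>{..j}. {v \<in> S. f v = i})" by auto
    then have "card S \<le> card {v \<in> S. j < f v} + card (\<Union>i\<in>{..j}. {v \<in> S. f v = i})"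
      by (metis card_Un_le)
    also have "card (\<Union>i\<in>{..j}. {v \<in> S. f v = i}) \<le> (\<Sum>i\<in>{..j}. card {v \<in> S. f v = i})"
      by (rule card_UN_le) simp
    also have "\<dots> \<le> (\<Sum>i\<in>{..j}. t)" using cls j by (intro sum_mono) auto
    also have "\<dots> = Suc j * t" by simp
    also have "\<dots> \<le> k * t" using j by (intro mult_le_mono1) simp
    finally have "card S \<le> card {v \<in> S. j < f v} + k * t" by simp
    with kt show ?thesis by simp
  qed
  have "real k * real (card S) / 2 = (\<Sum>j<k. real (card S) / 2)" by simp
  also have "\<dots> \<le> (\<Sum>j<k. real (card {v \<in> S. j < f v}))" using big by (intro sum_mono) auto
  also have "\<dots> = real (card K)" unfolding K_def using finS by (simp add: card_SigmaI)
  finally have Kbig: "real k * real (card S) / 2 \<le> real (card K)" .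
  have "pr p (pairs V) (\<lambda>F. \<forall>j<k. \<forall>v\<in>S. j < f v \<longrightarrow> (\<exists>i\<in>S. f i = j \<and> graph_of F v i))
      \<le> pr p (pairs V) (\<lambda>F. \<forall>z\<in>K. F \<inter> T z \<noteq> {})"
  proof (rule pr_mono[OF finite_pairs[OF V(1)] p])
    fix F assume F: "\<forall>j<k. \<forall>v\<in>S. j < f v \<longrightarrow> (\<exists>i\<in>S. f i = j \<and> graph_of F v i)"
    show "\<forall>z\<in>K. F \<inter> T z \<noteq> {}"
    proof
      fix z assume "z \<in> K"
      then obtain j v where z: "z = (j, v)" "j < k" "v \<in> S" "j < f v" by (auto simp: K_def)
      with F obtain i where "i \<in> S" "f i = j" "{v, i} \<in> F" unfolding graph_of_def by blast
      then show "F \<inter> T z \<noteq> {}" unfolding z T_def by auto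
    qed
  qed
  also have "\<dots> = (\<Prod>z\<in>K. 1 - (1 - p) ^ card (T z))"
    by (rule pr_hit_all[OF finK finite_pairs[OF V(1)] TU dis])
  also have "\<dots> \<le> (\<Prod>z\<in>K. exp (- ((1 - p) ^ t)))"
  proof (rule prod_mono)
    fix z assume z: "z \<in> K"
    have "(1 - p) ^ t \<le> (1 - p) ^ card (T z)" using cT z p
      by (cases z) (auto intro!: power_decreasing)
    moreover have "(1 - p) ^ card (T z) \<le> 1" using p by (intro power_le_one) auto
    ultimately show "0 \<le> 1 - (1 - p) ^ card (T z) \<and> 1 - (1 - p) ^ card (T z) \<le> exp (- ((1 - p) ^ t))"
      using exp_ge_add_one_self[of "- ((1 - p) ^ t)"] by auto
  qed
  also have "\<dots> = exp (- (real (card K) * (1 - p) ^ t))"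
    by (simp add: exp_of_nat_mult[symmetric])
  also have "\<dots> \<le> exp (- (real k * real (card S) / 2 * (1 - p) ^ t))"
    using mult_right_mono[OF Kbig, of "(1 - p) ^ t"] p by simp
  finally show ?thesis .
qed

text \<open>Without an independent \<open>t\<close>-subset all independent sets in \<open>S\<close>
  have size at most \<open>t\<close>, so a greedy colouring with small classes exists. The union
  bound runs over at most \<open>Suc k ^ card S\<close> colourings.\<close>

lemma pr_no_indep_subset_greedy:
  fixes p :: real
  assumes p: "0 \<le> p" "p \<le> 1" and V: "finite V" "S \<subseteq> V" and kt: "2 * k * t \<le> card S"
  shows "pr p (pairs V) (\<lambda>F. \<forall>I\<subseteq>S. card I = t \<longrightarrow> F \<inter> pairs I \<noteq> {})
    \<le> real (Suc k) ^ card S * exp (- (real k * real (card S) / 2 * (1 - p) ^ t))"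
proof -
  let ?U = "pairs V"
  have finS: "finite S" using V finite_subset by blast
  have finU: "finite ?U" using V finite_pairs by blast
  define A where "A = {f \<in> S \<rightarrow>\<^sub>E {..k}. \<forall>j<k. card {v \<in> S. f v = j} \<le> t}"
  let ?Q = "\<lambda>f F. \<forall>j<k. \<forall>v\<in>S. j < f v \<longrightarrow> (\<exists>i\<in>S. f i = j \<and> graph_of F v i)"
  have finP: "finite (S \<rightarrow>\<^sub>E {..k})" using finS by (intro finite_PiE) auto
  have finA: "finite A" unfolding A_def using finP by simp
  have "card A \<le> card (S \<rightarrow>\<^sub>E {..k})" unfolding A_def using finP by (intro card_mono) auto
  also have "\<dots> = Suc k ^ card S" using finS by (simp add: card_PiE)
  finally have "card A \<le> Suc k ^ card S" .
  then have cA: "real (card A) \<le> real (Suc k) ^ card S"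
    by (metis of_nat_le_iff of_nat_power)
  have "pr p ?U (\<lambda>F. \<forall>I\<subseteq>S. card I = t \<longrightarrow> F \<inter> pairs I \<noteq> {}) \<le> pr p ?U (\<lambda>F. \<exists>f\<in>A. ?Q f F)"
  proof (rule pr_mono[OF finU p])
    fix F assume F: "F \<subseteq> ?U" and no: "\<forall>I\<subseteq>S. card I = t \<longrightarrow> F \<inter> pairs I \<noteq> {}"
    have small: "card I \<le> t" if I: "I \<subseteq> S" "\<forall>u\<in>I. \<forall>v\<in>I. \<not> graph_of F u v" for I
    proof (rule ccontr)
      assume "\<not> card I \<le> t"
      then obtain J where J: "J \<subseteq> I" "card J = t" using obtain_subset_with_card_n[of t I] by auto
      then have "F \<inter> pairs J = {}" using I independent_iff[OF F, of I] pairs_mono[OF J(1)] by blast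
      with no J I show False by blast
    qed
    obtain f :: "'a \<Rightarrow> nat" where f: "\<And>v. f v \<le> k" "\<And>j. j < k \<Longrightarrow> card {v \<in> S. f v = j} \<le> t" "?Q f F"
      using greedy_colouring[of S "graph_of F" t k, OF finS graph_of_sym graph_of_irrefl[OF F] small] by blast
    \<comment> \<open>Restriction to \<open>S\<close> places the colouring in a finite space of
      extensional functions.\<close>
    let ?f = "restrict f S"
    have "{v \<in> S. ?f v = j} = {v \<in> S. f v = j}" for j by auto
    then have "?f \<in> A" using f by (auto simp: A_def)
    moreover have "?Q ?f F" using f(3) by auto
    ultimately show "\<exists>f\<in>A. ?Q f F" by blast
  qed
  also have "\<dots> \<le> real (card A) * exp (- (real k * real (card S) / 2 * (1 - p) ^ t))"
    by (rule pr_union_bound[OF finU p finA], rule pr_greedy_colouring[OF p V kt]) (auto simp: A_def)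
  also have "\<dots> \<le> real (Suc k) ^ card S * exp (- (real k * real (card S) / 2 * (1 - p) ^ t))"
    using cA by (intro mult_right_mono) auto
  finally show ?thesis .
qed

section \<open>Edge counts and triangle packings in a random graph\<close>

lemma pr_many_edges:
  assumes p: "0 \<le> p" "p \<le> 1" and V: "finite V" "S \<subseteq> V"
  shows "pr p (pairs V) (\<lambda>F. m \<le> card (F \<inter> pairs S)) \<le> real ((card S choose 2) choose m) * p ^ m"
proof -
  have finS: "finite S" using V finite_subset by blast
  let ?T = "{T. T \<subseteq> pairs S \<and> card T = m}"
  have finT: "finite ?T" using finite_pairs[OF finS] by simp
  have "pr p (pairs V) (\<lambda>F. m \<le> card (F \<inter> pairs S)) \<le> pr p (pairs V) (\<lambda>F. \<exists>T\<in>?T. T \<subseteq> F)"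
  proof (rule pr_mono[OF finite_pairs[OF V(1)] p])
    fix F assume "m \<le> card (F \<inter> pairs S)"
    then obtain T where "T \<subseteq> F \<inter> pairs S" "card T = m" using obtain_subset_with_card_n by blast
    then show "\<exists>T\<in>?T. T \<subseteq> F" by blast
  qed
  also have "\<dots> \<le> real (card ?T) * p ^ m"
  proof (rule pr_union_bound[OF finite_pairs[OF V(1)] p finT])
    fix T assume T: "T \<in> ?T"
    then have "T \<subseteq> pairs V" using pairs_mono[OF V(2)] by blast
    with T show "pr p (pairs V) (\<lambda>F. T \<subseteq> F) \<le> p ^ m"
      using pr_subset[OF finite_pairs[OF V(1)], of T p] by simp
  qed
  also have "card ?T = (card S choose 2) choose m"
    using n_subsets[OF finite_pairs[OF finS]] card_pairs[OF finS] by simp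
  finally show ?thesis .
qed

text \<open>Union bound over families of \<open>M\<close> triples; a packing occupies exactly
  \<open>3 * M\<close> distinct pairs, so it is present with probability
  \<open>p ^ (3 * M)\<close>.\<close>

lemma pr_packing:
  assumes p: "0 \<le> p" "p \<le> 1" and V: "finite V" "S \<subseteq> V"
  shows "pr p (pairs V) (\<lambda>F. \<exists>P. packing S P \<and> \<Union> (pairs ` P) \<subseteq> F \<and> card P = M)
    \<le> real ((card S choose 3) choose M) * p ^ (3 * M)"
proof -
  have finS: "finite S" using V finite_subset by blast
  let ?A = "{\<tau>. \<tau> \<subseteq> S \<and> card \<tau> = 3}"
  let ?B = "{P. P \<subseteq> ?A \<and> card P = M}"
  let ?C = "{P \<in> ?B. packing S P}"
  have finA: "finite ?A" using finS by simp
  then have finB: "finite ?B" by simp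
  have cA: "card ?A = card S choose 3" by (rule n_subsets[OF finS])
  have cB: "card ?B = (card S choose 3) choose M" using n_subsets[OF finA] cA by simp
  have cC: "card ?C \<le> card ?B" using finB by (intro card_mono) auto
  have finC: "finite ?C" by (rule finite_subset[OF _ finB]) auto
  have "pr p (pairs V) (\<lambda>F. \<exists>P. packing S P \<and> \<Union> (pairs ` P) \<subseteq> F \<and> card P = M)
      = pr p (pairs V) (\<lambda>F. \<exists>P\<in>?C. \<Union> (pairs ` P) \<subseteq> F)"
    by (rule pr_cong) (auto simp: packing_def)
  also have "\<dots> \<le> real (card ?C) * p ^ (3 * M)"
  proof (rule pr_union_bound[OF finite_pairs[OF V(1)] p finC])
    fix P assume P: "P \<in> ?C"
    have "pairs \<tau> \<subseteq> pairs V" if "\<tau> \<in> P" for \<tau>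
    proof (rule pairs_mono)
      show "\<tau> \<subseteq> V" using that P V(2) by auto
    qed
    then have sub: "\<Union> (pairs ` P) \<subseteq> pairs V" by blast
    have "card (\<Union> (pairs ` P)) = 3 * M" using card_pairs_packing[OF finS] P by simp
    with pr_subset[OF finite_pairs[OF V(1)] sub, of p]
    show "pr p (pairs V) (\<lambda>F. \<Union> (pairs ` P) \<subseteq> F) \<le> p ^ (3 * M)" by simp
  qed
  also have "\<dots> \<le> real ((card S choose 3) choose M) * p ^ (3 * M)"
    using cC cB p by (intro mult_right_mono) auto
  finally show ?thesis .
qed

text \<open>Joins the maximal packing to the colour class argument: the at most \<open>3 * M\<close>
  edges meeting all triangles count as \<open>6 * M\<close> ordered pairs, the at most
  \<open>m\<close> edges inside \<open>S\<close> as \<open>2 * m\<close>.\<close>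

lemma few_triangles_indep_set:
  fixes D :: real
  assumes fin: "finite V" and S: "S \<subseteq> V" and F: "F \<subseteq> pairs V"
    and m: "card (F \<inter> pairs S) \<le> m"
    and M: "\<And>P. packing S P \<Longrightarrow> \<Union> (pairs ` P) \<subseteq> F \<Longrightarrow> card P \<noteq> M"
    and D: "1 \<le> D" and r: "1 \<le> r"
    and few: "6 * real M + 2 * real m / D \<le> real r * real (card S) / 2"
  obtains W where "W \<subseteq> S" "F \<inter> pairs W = {}" "ln D / (32 * D * real r) * real (card S) \<le> real (card W)"
proof -
  let ?F = "F \<inter> pairs S"
  have finS: "finite S" using S fin finite_subset by blast
  have FS: "?F \<subseteq> pairs S" by simp
  obtain X where X: "X \<subseteq> ?F" "card X \<le> 3 * M"
    and tri: "\<And>a b c. {a, b} \<in> ?F \<Longrightarrow> {a, c} \<in> ?F \<Longrightarrow> {b, c} \<in> ?F \<Longrightarrow> {a, b} \<in> X \<or> {a, c} \<in> X \<or> {b, c} \<in> X"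
    by (rule maximal_packing_hits_triangles[OF finS FS, of M]) (use M in auto)
  have XS: "X \<subseteq> pairs S" using X by blast
  have cX: "real (card {(u, v). u \<in> S \<and> v \<in> S \<and> graph_of X u v}) \<le> 6 * real M"
    using card_ordered_pairs[OF finS XS] X(2) unfolding graph_of_def by linarith
  have "real (card {(u, v). u \<in> S \<and> v \<in> S \<and> graph_of ?F u v}) \<le> 2 * real m"
    using card_ordered_pairs[OF finS FS] m unfolding graph_of_def by linarith
  then have "real (card {(u, v). u \<in> S \<and> v \<in> S \<and> graph_of ?F u v}) / D \<le> 2 * real m / D"
    using D by (intro divide_right_mono) auto
  with cX few have few': "real (card {(u, v). u \<in> S \<and> v \<in> S \<and> graph_of X u v})
      + real (card {(u, v). u \<in> S \<and> v \<in> S \<and> graph_of ?F u v}) / D \<le> real r * real (card S) / 2"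
    by linarith
  have tri': "graph_of X a b \<or> graph_of X a c \<or> graph_of X b c"
    if "graph_of ?F a b" "graph_of ?F a c" "graph_of ?F b c" for a b c
    using that tri unfolding graph_of_def by blast
  obtain W where W: "W \<subseteq> S" "\<forall>u\<in>W. \<forall>w\<in>W. \<not> graph_of ?F u w"
    "ln D / (32 * D * real r) * real (card S) \<le> real (card W)"
    by (rule nearly_triangle_free_indep_set[OF finS graph_of_sym graph_of_irrefl[OF FS] graph_of_sym
          graph_of_irrefl[OF XS] tri' D r few'])
  have "?F \<inter> pairs W = {}" using W(2) independent_iff[OF FS] by blast
  then have "F \<inter> pairs W = {}" using pairs_mono[OF W(1)] by blast
  with W that show ?thesis by blast
qed

text \<open>Failure forces at least \<open>m\<close> edges inside \<open>S\<close> or a packing of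
  exactly \<open>M\<close> triangles, because otherwise the deterministic bound yields an
  independent set of size at least \<open>t\<close>.\<close>

lemma pr_no_indep_subset_sparse:
  fixes p D :: real
  assumes p: "0 \<le> p" "p \<le> 1" and V: "finite V" "S \<subseteq> V" and D: "1 \<le> D" and r: "1 \<le> r"
    and few: "6 * real M + 2 * real m / D \<le> real r * real (card S) / 2"
    and t: "real t \<le> ln D / (32 * D * real r) * real (card S)"
  shows "pr p (pairs V) (\<lambda>F. \<forall>I\<subseteq>S. card I = t \<longrightarrow> F \<inter> pairs I \<noteq> {})
    \<le> real ((card S choose 2) choose m) * p ^ m + real ((card S choose 3) choose M) * p ^ (3 * M)"
proof -
  let ?A = "\<lambda>F. m \<le> card (F \<inter> pairs S)"
  let ?B = "\<lambda>F. \<exists>P. packing S P \<and> \<Union> (pairs ` P) \<subseteq> F \<and> card P = M"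
  have "pr p (pairs V) (\<lambda>F. \<forall>I\<subseteq>S. card I = t \<longrightarrow> F \<inter> pairs I \<noteq> {}) \<le> pr p (pairs V) (\<lambda>F. ?A F \<or> ?B F)"
  proof (rule pr_mono[OF finite_pairs[OF V(1)] p])
    fix F assume F: "F \<subseteq> pairs V" and no: "\<forall>I\<subseteq>S. card I = t \<longrightarrow> F \<inter> pairs I \<noteq> {}"
    show "?A F \<or> ?B F"
    proof (rule ccontr)
      assume n: "\<not> ?thesis"
      have 1: "card (F \<inter> pairs S) \<le> m" using n by auto
      have 2: "card P \<noteq> M" if "packing S P" "\<Union> (pairs ` P) \<subseteq> F" for P using n that by blast
      obtain W where W: "W \<subseteq> S" "F \<inter> pairs W = {}" "ln D / (32 * D * real r) * real (card S) \<le> real (card W)"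
        by (rule few_triangles_indep_set[OF V F 1 2 D r few])
      then have "t \<le> card W" using t by linarith
      then obtain I where I: "I \<subseteq> W" "card I = t" using obtain_subset_with_card_n by blast
      then have "F \<inter> pairs I = {}" using W(2) pairs_mono[OF I(1)] by blast
      with no I W(1) show False by blast
    qed
  qed
  also have "\<dots> \<le> pr p (pairs V) ?A + pr p (pairs V) ?B"
    by (rule pr_disj[OF finite_pairs[OF V(1)] p])
  also note add_mono[OF pr_many_edges[OF p V] pr_packing[OF p V]]
  finally show ?thesis .
qed

section \<open>From failure probabilities to a graph\<close>

text \<open>The two failure events, an independent \<open>k\<close>-set and a bad
  \<open>s\<close>-set, have probability at most \<open>1 / 4\<close> each; \<open>n ^ s\<close>
  bounds the number of \<open>s\<close>-sets.\<close>

lemma random_graph_exists: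
  fixes p b :: real
  assumes p: "0 \<le> p" "p \<le> 1"
    and k: "real (n choose k) * (1 - p) ^ (k choose 2) \<le> 1 / 4"
    and b: "real n ^ s * b \<le> 1 / 4" "0 \<le> b"
    and S: "\<And>S. S \<subseteq> {..<n} \<Longrightarrow> card S = s \<Longrightarrow>
      pr p (pairs {..<n}) (\<lambda>F. \<forall>I\<subseteq>S. card I = t \<longrightarrow> F \<inter> pairs I \<noteq> {}) \<le> b"
  shows "\<exists>E. graph_on n E \<and> alpha n E < k \<and> s_t_property n E s t"
proof -
  let ?U = "pairs {..<n}"
  have finU: "finite ?U" by (simp add: finite_pairs)
  let ?A = "\<lambda>F. \<exists>S\<in>{S. S \<subseteq> {..<n} \<and> card S = k}. F \<inter> pairs S = {}"
  let ?B = "\<lambda>F. \<exists>S\<in>{S. S \<subseteq> {..<n} \<and> card S = s}. \<forall>I\<subseteq>S. card I = t \<longrightarrow> F \<inter> pairs I \<noteq> {}"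
  have "pr p ?U ?B \<le> real (card {S. S \<subseteq> {..<n} \<and> card S = s}) * b"
    by (rule pr_union_bound[OF finU p]) (use S in auto)
  also have "\<dots> = real (n choose s) * b" by (simp add: n_subsets)
  also have "\<dots> \<le> real n ^ s * b" using b by (intro mult_right_mono binomial_le_power)
  finally have B: "pr p ?U ?B \<le> 1 / 4" using b by linarith
  have A: "pr p ?U ?A \<le> 1 / 4" using pr_large_indep[OF p, of n k] k by linarith
  have less: "pr p ?U (\<lambda>F. ?A F \<or> ?B F) < 1"
    using pr_disj[OF finU p, of ?A ?B] A B by linarith
  obtain F where FU: "F \<subseteq> ?U" and nF: "\<not> (?A F \<or> ?B F)"
    by (rule pr_less_one_ex[OF finU less])
  from nF have F: "F \<subseteq> ?U" "\<not> ?A F" "\<not> ?B F" using FU by simp_all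
  have "\<not> indep_set (graph_of F) S" if "S \<subseteq> {..<n}" "card S = k" for S
    using F(2) that unfolding indep_set_graph_of[OF F(1)] by blast
  then have "alpha n (graph_of F) < k" by (rule alpha_less)
  moreover have "s_t_property n (graph_of F) s t"
    unfolding s_t_property_def
  proof (intro allI impI)
    fix S assume "S \<subseteq> {..<n} \<and> card S = s"
    then have "\<exists>I\<subseteq>S. card I = t \<and> F \<inter> pairs I = {}" using F(3) by blast
    then show "\<exists>I\<subseteq>S. card I = t \<and> indep_set (graph_of F) I"
      by (simp only: indep_set_graph_of[OF F(1)])
  qed
  ultimately show ?thesis using graph_on_graph_of[OF F(1)] by blast
qed

section \<open>Choice of parameters\<close>

lemma exp_neg_le_quarter:
  fixes z :: real assumes "3 \<le> z" shows "exp (- z) \<le> 1 / 4"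
proof -
  have "4 \<le> exp z" using exp_ge_add_one_self[of z] assms by linarith
  then show ?thesis by (simp add: exp_minus field_simps)
qed

lemma exp_le_one_minus:
  fixes p :: real assumes "0 \<le> p" "p \<le> 1 / 2" shows "exp (- (2 * p)) \<le> 1 - p"
proof -
  have "p * p \<le> 1 / 2 * p" using assms by (intro mult_right_mono) auto
  then have "- (2 * p) \<le> - p - 2 * p\<^sup>2" by (simp add: power2_eq_square)
  also have "\<dots> \<le> ln (1 - p)" using assms by (rule ln_one_minus_pos_lower_bound)
  finally have "exp (- (2 * p)) \<le> exp (ln (1 - p))" by simp
  also have "\<dots> = 1 - p" using assms by (simp add: exp_ln)
  finally show ?thesis .
qed

text \<open>This is where \<open>s \<le> exp (2 * t)\<close> enters: for
  \<open>\<epsilon> \<le> 1 / 4\<close> it keeps the density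
  \<open>\<epsilon> * ln (s / t) / t\<close> at most \<open>1 / 2\<close>.\<close>

lemma ln_ratio_le:
  assumes "1 \<le> t" "0 < s" "real s \<le> exp (2 * real t)" shows "ln (real s / real t) \<le> 2 * real t"
proof -
  have "ln (real s / real t) \<le> ln (real s)"
    using assms by (subst ln_le_cancel_iff) (auto simp: field_simps)
  also have "\<dots> \<le> ln (exp (2 * real t))" using assms by (subst ln_le_cancel_iff) auto
  finally show ?thesis by simp
qed

lemma real_choose_two: "real (k choose 2) = real k * (real k - 1) / 2"
proof (cases k)
  case (Suc j)
  have "even (k * (k - 1))" by (cases k) auto
  then have "real (k choose 2) = real (k * (k - 1)) / 2"
    by (simp add: choose_two real_of_nat_div)
  then show ?thesis using Suc by (simp add: algebra_simps)
qed simp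

text \<open>The number of \<open>k\<close>-sets is at most \<open>exp (k * ln y)\<close>, while each
  of them is independent with probability at most \<open>exp (- (4 * k * ln y))\<close>.\<close>

lemma expected_independent_small:
  fixes p y :: real
  assumes p: "0 \<le> p" "p \<le> 1" and k: "2 \<le> k" and y: "2 \<le> y" "exp 1 * real n \<le> y * real k"
    and pk: "16 * ln y \<le> p * real k"
  shows "real (n choose k) * (1 - p) ^ (k choose 2) \<le> 1 / 4"
proof -
  have "exp (1 / 2) \<le> y" using exp_half_le2 y by linarith
  then have ly: "1 / 2 \<le> ln y" using y by (subst ln_ge_iff) auto
  have "real (n choose k) \<le> (exp 1 * real n / real k) ^ k" by (rule binomial_le_exp_pow)
  also have "\<dots> \<le> y ^ k" using y k by (intro power_mono) (auto simp: field_simps)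
  also have "\<dots> = exp (real k * ln y)" using y by (simp add: exp_of_nat_mult)
  finally have 1: "real (n choose k) \<le> exp (real k * ln y)" .
  have c: "real (k choose 2) = real k * (real k - 1) / 2" by (rule real_choose_two)
  have "real k / 2 \<le> real k - 1" using k by simp
  then have "p * (real k / 2) \<le> p * (real k - 1)" using p by (intro mult_left_mono)
  with pk have "4 * ln y \<le> p * (real k - 1) / 2" by simp
  then have "real k * (4 * ln y) \<le> real k * (p * (real k - 1) / 2)" by (intro mult_left_mono) auto
  then have "- (p * real (k choose 2)) \<le> - (real k * (4 * ln y))" unfolding c by (simp add: mult_ac)
  then have 2: "(1 - p) ^ (k choose 2) \<le> exp (- (real k * (4 * ln y)))"
    using one_minus_power_le_exp[OF p, of "k choose 2"] by (meson exp_le_cancel_iff order_trans)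
  have "real (n choose k) * (1 - p) ^ (k choose 2) \<le> exp (real k * ln y) * exp (- (real k * (4 * ln y)))"
    using 1 2 p by (intro mult_mono) auto
  also have "\<dots> = exp (- (real k * (3 * ln y)))" by (simp add: exp_add[symmetric] algebra_simps)
  also have "\<dots> \<le> 1 / 4"
  proof (rule exp_neg_le_quarter)
    have "2 * (3 * (1 / 2)) \<le> real k * (3 * ln y)" using k ly by (intro mult_mono) auto
    then show "3 \<le> real k * (3 * ln y)" by simp
  qed
  finally show ?thesis .
qed

text \<open>The part common to both ranges: it settles the independence number and the bounds on
  \<open>p\<close>, and leaves the estimate for a fixed \<open>s\<close>-set as the premise
  \<open>S\<close>.\<close>

lemma random_graph_alpha_bound:
  fixes \<epsilon> b p :: real and n s t :: nat
  assumes \<epsilon>: "0 < \<epsilon>" "\<epsilon> \<le> 1 / 4" and t: "1 \<le> t" "t < s" "2 * s \<le> n" and st: "real s \<le> exp (2 * real t)"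
    and p: "p = \<epsilon> * ln (real s / real t) / real t"
    and b: "0 \<le> b" "real n ^ s * b \<le> 1 / 4"
    and S: "\<And>S. 0 \<le> p \<Longrightarrow> p \<le> 1 / 2 \<Longrightarrow> S \<subseteq> {..<n} \<Longrightarrow> card S = s \<Longrightarrow>
      pr p (pairs {..<n}) (\<lambda>F. \<forall>I\<subseteq>S. card I = t \<longrightarrow> F \<inter> pairs I \<noteq> {}) \<le> b"
  shows "\<exists>E. graph_on n E \<and>
      real (alpha n E) \<le> 16 / \<epsilon> * (real t / ln (real s / real t)) * ln (real n / real t) \<and> s_t_property n E s t"
proof -
  define x where "x = real s / real t"
  define y where "y = real n / real t"
  define K where "K = 16 / \<epsilon> * (real t / ln x) * ln y"
  \<comment> \<open>The smallest integer above \<open>K\<close>, so that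
    \<open>alpha n E < k\<close> gives the real bound \<open>K\<close>.\<close>
  define k where "k = nat \<lfloor>K\<rfloor> + 1"
  have x1: "1 < x" using t by (simp add: x_def)
  then have lx: "0 < ln x" by simp
  have y2: "2 \<le> y" using t by (simp add: y_def field_simps)
  have xy: "x \<le> y" unfolding x_def y_def using t by (intro divide_right_mono) auto
  then have lxy: "ln x \<le> ln y" using x1 by simp
  have lx2: "ln x \<le> 2 * real t" using ln_ratio_le[OF t(1) _ st] t by (simp add: x_def)
  have pp: "p = \<epsilon> * ln x / real t" by (simp add: p x_def)
  have p0: "0 < p" using \<epsilon> lx t by (simp add: pp)
  have "\<epsilon> * ln x \<le> 1 / 4 * (2 * real t)" using \<epsilon> lx lx2 by (intro mult_mono) auto
  then have p1: "p \<le> 1 / 2" using t by (simp add: pp field_simps)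
  \<comment> \<open>From \<open>ln x \<le> ln y\<close> follows \<open>K \<ge> 64 * t\<close>, which
    lets \<open>y * k\<close> dominate \<open>exp 1 * n\<close> below.\<close>
  have "16 / \<epsilon> * real t * 1 \<le> 16 / \<epsilon> * real t * (ln y / ln x)"
    using lx lxy \<epsilon> by (intro mult_left_mono) (auto simp: field_simps)
  then have Kt: "16 / \<epsilon> * real t \<le> K" by (simp add: K_def)
  have "64 * real t \<le> 16 / \<epsilon> * real t" using \<epsilon> by (intro mult_right_mono) (auto simp: field_simps)
  with Kt have K64: "64 * real t \<le> K" by linarith
  have K0: "0 \<le> K" using K64 t by linarith
  have kK: "K < real k" "real (nat \<lfloor>K\<rfloor>) \<le> K" using K0 unfolding k_def by linarith+
  \<comment> \<open>The factor 16 in \<open>K\<close> is the one demanded by the first moment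
    bound.\<close>
  have pK: "p * K = 16 * ln y" using \<epsilon> lx t by (simp add: pp K_def)
  have A: "real (n choose k) * (1 - p) ^ (k choose 2) \<le> 1 / 4"
  proof (rule expected_independent_small[of p k y])
    have "64 \<le> real k" using K64 kK t by (smt (verit) of_nat_1 of_nat_mono)
    then show "2 \<le> k" by simp
    have "exp 1 * real n \<le> 3 * real n" using exp_le by (intro mult_right_mono) auto
    also have "\<dots> = 3 * (y * real t)" using t by (simp add: y_def)
    also have "\<dots> \<le> y * real k"
    proof -
      have "3 * real t \<le> real k" using K64 kK by linarith
      then have "y * (3 * real t) \<le> y * real k" using y2 by (intro mult_left_mono) auto
      then show ?thesis by (simp add: mult_ac)
    qed
    finally show "exp 1 * real n \<le> y * real k" .
    have "p * K \<le> p * real k" using kK p0 by (intro mult_left_mono) auto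
    then show "16 * ln y \<le> p * real k" using pK by simp
  qed (use p0 p1 y2 in auto)
  have "\<exists>E. graph_on n E \<and> alpha n E < k \<and> s_t_property n E s t"
    by (rule random_graph_exists[OF _ _ A b(2,1) S]) (use p0 p1 in auto)
  then obtain E where E: "graph_on n E" "alpha n E < k" "s_t_property n E s t" by blast
  have "alpha n E \<le> nat \<lfloor>K\<rfloor>" using E(2) by (simp add: k_def)
  then have "real (alpha n E) \<le> K" using kK(2) by linarith
  then show ?thesis using E unfolding K_def x_def y_def by blast
qed

section \<open>The range of large ratios\<close>

text \<open>At density \<open>\<delta> / 4 * ln z / t\<close> a vertex has no neighbour in a class
  of size at most \<open>t\<close> with probability at least
  \<open>z powr (- (\<delta> / 2))\<close>. About \<open>z / 2\<close> rounds then give an exponent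
  of order \<open>s * z powr (1 - \<delta> / 2)\<close>, which beats
  \<open>s * ln n\<close>.\<close>

lemma graph_exists_large_ratio:
  fixes \<delta> :: real and n s t :: nat
  assumes \<delta>: "0 < \<delta>" "\<delta> \<le> 1" and t: "1 \<le> t" "t < s" "2 * s \<le> n" and st: "real s \<le> exp (2 * real t)"
    and x: "ln (real n) \<le> (real s / real t) powr (1 - \<delta>)" "48 \<le> (real s / real t) powr (\<delta> / 2)"
    "4 \<le> real s / real t" and L: "1 \<le> ln (real n)"
  shows "\<exists>E. graph_on n E \<and>
      real (alpha n E) \<le> 64 / \<delta> * (real t / ln (real s / real t)) * ln (real n / real t) \<and> s_t_property n E s t"
proof -
  define z where "z = real s / real t"
  define p where "p = \<delta> / 4 * ln z / real t"
  define k where "k = s div (2 * t)"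
  define L where "L = ln (real n)"
  define b where "b = real (Suc k) ^ s * exp (- (real k * real s / 2 * (1 - p) ^ t))"
  have z4: "4 \<le> z" using x(3) by (simp add: z_def)
  have z1: "0 < z" "1 < z" using x(3) by (auto simp: z_def)
  have p0: "0 \<le> p" using \<delta> z1 by (simp add: p_def)
  have n0: "0 < real n" using t by simp
  have kt: "2 * k * t \<le> s"
    unfolding k_def by (metis div_times_less_eq_dividend mult.assoc mult.commute)
  have b_le: "real n ^ s * b \<le> 1 / 4" if p1: "p \<le> 1 / 2"
  proof -
    have "real s < real (2 * t) * (real k + 1)"
      unfolding k_def using t dividend_less_times_div[of "2 * t" s]
      by (metis (no_types, lifting) Suc_eq_plus1 add.commute mult_Suc_right mult_pos_pos of_nat_1 of_nat_add of_nat_less_iff of_nat_mult zero_less_numeral less_le_trans zero_less_one)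
    then have "z < 2 * (real k + 1)" using t by (simp add: z_def field_simps)
    \<comment> \<open>As \<open>z \<ge> 4\<close>, rounding in \<open>k\<close> costs at most a
      factor 2.\<close>
    then have kz: "z / 4 \<le> real k" using z4 by (simp add: field_simps)
    have "z powr (- (\<delta> / 2)) = exp (- (2 * p)) ^ t"
      using z1 t by (simp add: powr_def p_def exp_of_nat_mult[symmetric])
    also have "\<dots> \<le> (1 - p) ^ t" using p0 p1 exp_le_one_minus by (intro power_mono) auto
    finally have pt: "z powr (- (\<delta> / 2)) \<le> (1 - p) ^ t" .
    \<comment> \<open>Of the factor 48, 8 absorbs \<open>k / 2 \<ge> z / 8\<close>; the remaining 6
      outweighs the choices of \<open>S\<close> and of the colouring, each at most
      \<open>n ^ s\<close>.\<close>
    have "48 * L \<le> z powr (\<delta> / 2) * z powr (1 - \<delta>)"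
      using x L unfolding z_def L_def by (intro mult_mono) auto
    also have "\<dots> = z * z powr (- (\<delta> / 2))"
      using z1 by (simp add: powr_add[symmetric] powr_mult_base)
    finally have "6 * L \<le> z / 8 * z powr (- (\<delta> / 2))" by simp
    also have "\<dots> \<le> real k / 2 * (1 - p) ^ t" using kz pt z1 by (intro mult_mono) auto
    finally have "6 * L * real s \<le> real k / 2 * (1 - p) ^ t * real s" by (intro mult_right_mono) auto
    then have e: "exp (- (real k * real s / 2 * (1 - p) ^ t)) \<le> exp (- (6 * L * real s))"
      by (simp add: mult_ac)
    have nL: "real n ^ s = exp (L * real s)" using n0 by (simp add: L_def exp_of_nat2_mult)
    have "Suc k \<le> n" using kt t by (cases t) auto
    then have "real (Suc k) ^ s \<le> real n ^ s" by (intro power_mono) auto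
    then have "real n ^ s * b \<le> real n ^ s * (real n ^ s * exp (- (6 * L * real s)))"
      unfolding b_def using e by (intro mult_left_mono mult_mono) auto
    also have "real n ^ s * (real n ^ s * exp (- (6 * L * real s))) = exp (- (4 * L * real s))"
      unfolding nL by (simp add: exp_add[symmetric])
    also have "\<dots> \<le> 1 / 4"
    proof (rule exp_neg_le_quarter)
      have "4 * 1 * 1 \<le> 4 * L * real s" using L t unfolding L_def by (intro mult_mono) auto
      then show "3 \<le> 4 * L * real s" by simp
    qed
    finally show ?thesis .
  qed
  have p1: "p \<le> 1 / 2"
  proof -
    have "ln z \<le> 2 * real t" using ln_ratio_le[OF t(1) _ st] t by (simp add: z_def)
    then have "\<delta> / 4 * ln z \<le> 1 / 4 * (2 * real t)" using \<delta> z1 by (intro mult_mono) auto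
    then show ?thesis using t by (simp add: p_def field_simps)
  qed
  have "\<exists>E. graph_on n E \<and>
      real (alpha n E) \<le> 16 / (\<delta> / 4) * (real t / ln (real s / real t)) * ln (real n / real t) \<and> s_t_property n E s t"
  proof (rule random_graph_alpha_bound[OF _ _ t st])
    show "p = \<delta> / 4 * ln (real s / real t) / real t" by (simp add: p_def z_def)
    show "real n ^ s * b \<le> 1 / 4" by (rule b_le[OF p1])
    show "0 \<le> b" by (simp add: b_def)
    fix S assume S: "S \<subseteq> {..<n}" "card S = s"
    show "pr p (pairs {..<n}) (\<lambda>F. \<forall>I\<subseteq>S. card I = t \<longrightarrow> F \<inter> pairs I \<noteq> {}) \<le> b"
      using pr_no_indep_subset_greedy[of p "{..<n}" S k t] p0 p1 S kt by (simp add: b_def)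
  qed (use \<delta> in auto)
  then show ?thesis by simp
qed

section \<open>The range of small ratios\<close>

text \<open>The mean number of edges is about \<open>s * d / 2\<close>, so \<open>m\<close> is at
  least ten times larger; the bound \<open>(exp 1 * N * p / m) ^ m\<close> with \<open>N\<close>
  pairs then has base at most \<open>exp 1 / 10 \<le> exp (- 1)\<close>.\<close>

lemma many_edges_unlikely:
  fixes p d :: real
  assumes p: "0 \<le> p" and d: "0 < d" and s: "0 < s" "real s * p = d" and m: "5 * real s * d \<le> real m"
  shows "real ((s choose 2) choose m) * p ^ m \<le> exp (- (5 * real s * d))"
proof -
  have m0: "0 < real m" using m d s by (smt (verit) mult_pos_pos of_nat_0_less_iff)
  have "real (s choose 2) = real s * (real s - 1) / 2" by (rule real_choose_two)
  also have "\<dots> \<le> real s * real s / 2" by (intro divide_right_mono mult_left_mono) auto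
  finally have c2: "real (s choose 2) \<le> real s * real s / 2" .
  have "exp 1 * exp 1 \<le> (3 * 3 :: real)" using exp_le by (intro mult_mono) auto
  then have e2: "exp 1 / 10 \<le> exp (- 1 :: real)" by (simp add: exp_minus field_simps)
  have "exp 1 * real (s choose 2) * p / real m \<le> exp 1 * (real s * real s / 2) * p / (5 * real s * d)"
    using c2 p m d s m0 by (intro frac_le mult_mono) auto
  also have "\<dots> = exp 1 / 10" using s d by (simp add: field_simps)
  also note e2
  finally have base: "exp 1 * real (s choose 2) * p / real m \<le> exp (- 1)" .
  have "real ((s choose 2) choose m) * p ^ m \<le> (exp 1 * real (s choose 2) / real m) ^ m * p ^ m"
    using p by (intro mult_right_mono binomial_le_exp_pow) auto
  also have "\<dots> = (exp 1 * real (s choose 2) * p / real m) ^ m"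
    by (simp add: power_mult_distrib[symmetric])
  also have "\<dots> \<le> exp (- 1) ^ m" using base p by (intro power_mono) auto
  also have "\<dots> = exp (- real m)" by (simp add: exp_of_nat_mult[symmetric])
  also have "\<dots> \<le> exp (- (5 * real s * d))" using m by simp
  finally show ?thesis .
qed

text \<open>Each triangle of the packing contributes a factor at most
  \<open>exp 1 * s ^ 3 * p ^ 3 / M\<close>, of order at most \<open>d ^ 2 * h / s\<close>. As
  \<open>d\<close> is small compared with \<open>s\<close>, this is at most
  \<open>1 / sqrt s\<close>, so the exponent gains \<open>ln s / 2\<close> per triangle.\<close>

lemma large_packing_unlikely:
  fixes p d h :: real
  assumes p: "0 \<le> p" and h: "1 \<le> h" "h \<le> d" and s: "0 < s" "real s * p = d"
    and d3: "3 * d ^ 3 \<le> exp (ln (real s) / 2)" and M: "real s * d / h \<le> real M"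
  shows "real ((s choose 3) choose M) * p ^ (3 * M) \<le> exp (- (real s * d / h * (ln (real s) / 2)))"
proof -
  have d: "0 < d" using h by linarith
  have "0 < real s * d / h" using d s h by simp
  then have M0: "0 < real M" using M by linarith
  have ls: "0 \<le> ln (real s)" using s by simp
  have c3: "real (s choose 3) \<le> real s ^ 3" by (rule binomial_le_power)
  have sp: "real s ^ 3 * p ^ 3 = d ^ 3" using s by (simp add: power_mult_distrib[symmetric])
  have "exp 1 * real (s choose 3) * p ^ 3 / real M \<le> 3 * real s ^ 3 * p ^ 3 / (real s * d / h)"
    using c3 exp_le p M M0 \<open>0 < real s * d / h\<close> by (intro frac_le mult_mono) auto
  also have "\<dots> = 3 * (real s ^ 3 * p ^ 3) * h / (real s * d)" using h by simp
  also have "\<dots> = 3 * d ^ 3 * h / (real s * d)" by (simp only: sp)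
  also have "\<dots> \<le> 3 * d ^ 3 * d / (real s * d)"
    using h d s by (intro divide_right_mono mult_left_mono) auto
  also have "\<dots> = 3 * d ^ 3 / real s" using d by simp
  also have "\<dots> \<le> exp (ln (real s) / 2) / real s" using d3 by (intro divide_right_mono) auto
  also have "\<dots> = exp (ln (real s) / 2) / exp (ln (real s))" using s by simp
  also have "\<dots> = exp (- (ln (real s) / 2))" by (simp add: exp_diff[symmetric])
  finally have base: "exp 1 * real (s choose 3) * p ^ 3 / real M \<le> exp (- (ln (real s) / 2))" .
  have "real ((s choose 3) choose M) * p ^ (3 * M) \<le> (exp 1 * real (s choose 3) / real M) ^ M * (p ^ 3) ^ M"
    unfolding power_mult using p by (intro mult_right_mono binomial_le_exp_pow) auto
  also have "\<dots> = (exp 1 * real (s choose 3) * p ^ 3 / real M) ^ M"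
    by (simp add: power_mult_distrib[symmetric])
  also have "\<dots> \<le> exp (- (ln (real s) / 2)) ^ M" using base p by (intro power_mono) auto
  also have "\<dots> = exp (- (real M * (ln (real s) / 2)))" by (simp add: exp_of_nat_mult[symmetric])
  also have "\<dots> \<le> exp (- (real s * d / h * (ln (real s) / 2)))"
    using mult_right_mono[OF M, of "ln (real s) / 2"] ls by simp
  finally show ?thesis .
qed

lemma nat_ceiling_bounds:
  fixes y :: real assumes "1 \<le> y" shows "y \<le> real (nat \<lceil>y\<rceil>)" "real (nat \<lceil>y\<rceil>) \<le> 2 * y"
    "real (nat \<lceil>y\<rceil>) \<le> y + 1"
  using assms by linarith+

text \<open>A packing of \<open>s * d / h\<close> triangles has to be less likely than
  \<open>n\<close> to the power \<open>- s\<close>. Since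
  \<open>d / h \<ge> L powr (1 - \<gamma> / 2)\<close> and
  \<open>ln s \<ge> L powr \<gamma>\<close>, its exponent exceeds \<open>s * L\<close> by a factor
  at least of order \<open>L powr (\<gamma> / 2)\<close>.\<close>

lemma graph_exists_small_ratio:
  fixes \<gamma> :: real and n s t :: nat
  defines "x \<equiv> real s / real t" and "L \<equiv> ln (real n)" and "\<epsilon> \<equiv> \<gamma> / 3136"
  assumes \<gamma>: "0 < \<gamma>" "\<gamma> \<le> 1" and t: "1 \<le> t" "t < s" "2 * s \<le> n" and st: "real s \<le> exp (2 * real t)"
    and dL: "L \<le> \<epsilon> * x * ln x" and x: "x \<le> L\<^sup>2" "1 \<le> \<epsilon> * ln x"
    and L: "1 \<le> L" "8 \<le> L powr (\<gamma> / 2)" "ln 3 + 12 * ln L \<le> L powr \<gamma> / 2" "L powr \<gamma> \<le> ln (real t)"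
  shows "\<exists>E. graph_on n E \<and>
      real (alpha n E) \<le> 16 / \<epsilon> * (real t / ln (real s / real t)) * ln (real n / real t) \<and> s_t_property n E s t"
proof -
  define p where "p = \<epsilon> * ln x / real t"
  \<comment> \<open>\<open>d\<close> is about the average degree in \<open>S\<close>,
    \<open>h\<close> the degree bound kept in a colour class, \<open>m\<close> and \<open>M\<close>
    the thresholds for edges and packed triangles, \<open>r\<close> the number of colours.\<close>
  define d where "d = \<epsilon> * x * ln x"
  define h where "h = d powr (\<gamma> / 2)"
  define m where "m = nat \<lceil>5 * real s * d\<rceil>"
  define M where "M = nat \<lceil>real s * d / h\<rceil>"
  define r where "r = nat \<lceil>48 * (d / h)\<rceil>"
  define b where "b = real ((s choose 2) choose m) * p ^ m + real ((s choose 3) choose M) * p ^ (3 * M)"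
  have \<epsilon>: "0 < \<epsilon>" "\<epsilon> \<le> 1 / 4" "\<epsilon> \<le> 1" using \<gamma> by (auto simp: \<epsilon>_def)
  have s0: "0 < s" "1 \<le> real s" "0 < real s" using t by auto
  have x1: "1 < x" using t by (simp add: x_def)
  have lx: "0 < ln x" "ln x \<le> x" using x1 ln_le_minus_one[of x] by auto
  have sp: "real s * p = d" using t by (simp add: p_def d_def x_def)
  have d1: "L \<le> d" "1 \<le> d" using dL L by (auto simp: d_def)
  have xd: "x \<le> d" using mult_left_mono[OF x(2), of x] x1 by (simp add: d_def mult_ac)
  \<comment> \<open>A bound on \<open>d\<close> by a power of \<open>L\<close>, to compare
    \<open>d ^ 3\<close> with \<open>sqrt s\<close> later.\<close>
  have "d \<le> 1 * x * x" unfolding d_def using \<epsilon> x1 lx by (intro mult_mono) auto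
  also have "\<dots> = x * x" by simp
  also have "\<dots> \<le> L\<^sup>2 * L\<^sup>2" using x x1 by (intro mult_mono) auto
  also have "\<dots> = L ^ 4" by (simp add: power_add[symmetric])
  finally have dL4: "d \<le> L ^ 4" .
  have h1: "1 \<le> h" using d1 \<gamma> by (simp add: h_def ge_one_powr_ge_zero)
  have "h \<le> d powr 1" unfolding h_def using d1 \<gamma> by (intro powr_mono) auto
  then have hd: "h \<le> d" using d1 by simp
  have dh: "d / h = d powr (1 - \<gamma> / 2)" using d1 by (simp add: h_def powr_diff)
  have dh1: "1 \<le> d / h" using h1 hd by simp
  have sd1: "1 \<le> real s * d" using s0 d1 by (metis mult_mono mult_1 zero_le_one order_trans)
  have sdh1: "1 \<le> real s * d / h"
    using mult_mono[of 1 "real s" 1 "d / h"] s0 dh1 by simp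
  have mb: "5 * real s * d \<le> real m" "real m \<le> 6 * (real s * d)"
    unfolding m_def using nat_ceiling_bounds[of "5 * real s * d"] sd1 by linarith+
  have Mb: "real s * d / h \<le> real M" "real M \<le> 2 * (real s * d / h)"
    unfolding M_def by (rule nat_ceiling_bounds[OF sdh1])+
  have dh48: "1 \<le> 48 * (d / h)" using dh1 by linarith
  have "real r \<le> 48 * (d / h) + 1" unfolding r_def by (rule nat_ceiling_bounds(3)[OF dh48])
  then have rb: "48 * (d / h) \<le> real r" "real r \<le> 49 * (d / h)"
    using dh1 nat_ceiling_bounds(1)[OF dh48] unfolding r_def[symmetric] by linarith+
  have r1: "1 \<le> r" using rb dh1 by (metis (no_types, opaque_lifting) One_nat_def Suc_leI of_nat_0_less_iff less_le_trans mult_pos_pos zero_less_numeral zero_less_one)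
  \<comment> \<open>Both terms on the left are at most \<open>12 * s * d / h\<close>, which explains
    the 48 in \<open>r\<close>.\<close>
  have few: "6 * real M + 2 * real m / h \<le> real r * real s / 2"
  proof -
    define y where "y = real s * d / h"
    have "2 * real m / h \<le> 2 * (6 * (real s * d)) / h"
      using h1 by (intro divide_right_mono mult_left_mono mb(2)) auto
    then have 1: "2 * real m / h \<le> 12 * y" by (simp add: y_def)
    have "48 * (d / h) * real s \<le> real r * real s" using rb by (intro mult_right_mono) auto
    then have 2: "48 * y \<le> real r * real s" by (simp add: y_def mult_ac)
    have "real M \<le> 2 * y" using Mb(2) by (simp only: y_def)
    with 1 2 show ?thesis by linarith
  qed
  have tW: "real t \<le> ln h / (32 * h * real r) * real s"
  proof -
    have "real r * h \<le> 49 * d" using rb(2) h1 by (simp add: field_simps)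
    then have den: "32 * h * real r \<le> 1568 * d" by (simp add: mult_ac)
    have "ln x \<le> ln d" using xd x1 by simp
    then have "\<gamma> / 2 * ln x \<le> \<gamma> / 2 * ln d" using \<gamma> by (intro mult_left_mono) auto
    also have "\<dots> = ln h" using d1 by (simp add: h_def ln_powr)
    finally have num: "\<gamma> / 2 * ln x \<le> ln h" .
    \<comment> \<open>The constant in \<open>\<epsilon>\<close> makes this an equality: 1568 = 32 *
      49 and 3136 = 2 * 1568.\<close>
    have "real t = \<gamma> / 2 * ln x / (1568 * d) * real s"
      using \<gamma> lx x1 t unfolding d_def \<epsilon>_def by (simp add: x_def field_simps)
    also have "\<dots> \<le> ln h / (32 * h * real r) * real s"
      using num den \<gamma> lx h1 r1 d1 by (intro mult_right_mono frac_le) auto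
    finally show ?thesis .
  qed
  have lts: "L powr \<gamma> \<le> ln (real s)"
  proof -
    have "ln (real t) \<le> ln (real s)" using t by simp
    with L(4) show ?thesis by linarith
  qed
  have p0: "0 \<le> p"
    unfolding p_def using \<epsilon> x1 by (intro divide_nonneg_nonneg mult_nonneg_nonneg) auto
  have b_le: "real n ^ s * b \<le> 1 / 4"
  proof -
    have t1: "real ((s choose 2) choose m) * p ^ m \<le> exp (- (4 * (real s * L)))"
    proof -
      have "real s * L \<le> real s * d" using d1 by (intro mult_left_mono) auto
      moreover have "0 \<le> real s * L" using L by simp
      ultimately have "4 * (real s * L) \<le> 5 * real s * d" by simp
      then have "exp (- (5 * real s * d)) \<le> exp (- (4 * (real s * L)))" by simp
      with many_edges_unlikely[OF p0 _ s0(1) sp mb(1)] d1 show ?thesis by linarith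
    qed
    have t2: "real ((s choose 3) choose M) * p ^ (3 * M) \<le> exp (- (4 * (real s * L)))"
    proof -
      have "3 * d ^ 3 \<le> 3 * (L ^ 4) ^ 3" using dL4 d1 by (intro mult_left_mono power_mono) auto
      also have "\<dots> = exp (ln 3 + 12 * ln L)"
      proof -
        have "exp (12 * ln L) = L ^ 12" using L exp_of_nat_mult[of 12 "ln L"] by simp
        then show ?thesis by (simp add: exp_add power_mult[symmetric])
      qed
      also have "\<dots> \<le> exp (ln (real s) / 2)" using L(3) lts by simp
      finally have d3: "3 * d ^ 3 \<le> exp (ln (real s) / 2)" .
      \<comment> \<open>The main use of the lower bound on \<open>ln t\<close>: the factor
        \<open>L powr \<gamma>\<close> gained from \<open>ln s\<close> outweighs the loss in
        \<open>d / h\<close>.\<close>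
      have "L * 8 \<le> L * L powr (\<gamma> / 2)" using L by (intro mult_left_mono) auto
      also have "\<dots> = L powr (1 - \<gamma> / 2) * L powr \<gamma>"
        using L by (simp add: powr_add[symmetric] powr_mult_base add.commute)
      also have "\<dots> \<le> d / h * ln (real s)"
        unfolding dh using d1 L \<gamma> lts by (intro mult_mono powr_mono2) auto
      finally have Ld: "L * 8 \<le> d / h * ln (real s)" .
      have "4 * (real s * L) = real s * (L * 8) / 2" by simp
      also have "\<dots> \<le> real s * (d / h * ln (real s)) / 2"
        by (rule divide_right_mono[OF mult_left_mono[OF Ld]]) auto
      also have "\<dots> = real s * d / h * (ln (real s) / 2)" by simp
      finally have "4 * (real s * L) \<le> real s * d / h * (ln (real s) / 2)" .
      then have "exp (- (real s * d / h * (ln (real s) / 2))) \<le> exp (- (4 * (real s * L)))" by simp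
      with large_packing_unlikely[OF p0 h1 hd s0(1) sp d3 Mb(1)] show ?thesis by linarith
    qed
    have nL: "real n ^ s = exp (real s * L)"
      using t by (simp add: L_def exp_of_nat_mult)
    have "real n ^ s * b \<le> exp (real s * L) * (2 * exp (- (4 * (real s * L))))"
      unfolding nL b_def using t1 t2 by (intro mult_left_mono) auto
    also have "\<dots> = 2 * exp (- (3 * (real s * L)))" by (simp add: exp_add[symmetric])
    also have "\<dots> \<le> exp 1 * exp (- (3 * (real s * L)))"
      using exp_ge_add_one_self[of 1] by (intro mult_right_mono) auto
    also have "\<dots> = exp (- (3 * (real s * L) - 1))" by (simp add: exp_add[symmetric])
    also have "\<dots> \<le> 1 / 4"
    proof (rule exp_neg_le_quarter)
      have "2 * 1 \<le> real s * L" using t L by (intro mult_mono) auto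
      then show "3 \<le> 3 * (real s * L) - 1" by simp
    qed
    finally show ?thesis .
  qed
  show ?thesis
  proof (rule random_graph_alpha_bound[OF \<epsilon>(1,2) t st])
    show "p = \<epsilon> * ln (real s / real t) / real t" by (simp add: p_def x_def)
    show "0 \<le> b" using p0 by (simp add: b_def)
    show "real n ^ s * b \<le> 1 / 4" by (rule b_le)
    fix S assume pS: "0 \<le> p" "p \<le> 1 / 2" "S \<subseteq> {..<n}" "card S = s"
    then have "p \<le> 1" by simp
    with pS few tW show "pr p (pairs {..<n}) (\<lambda>F. \<forall>I\<subseteq>S. card I = t \<longrightarrow> F \<inter> pairs I \<noteq> {}) \<le> b"
      using pr_no_indep_subset_sparse[of p "{..<n}" S h r M m t] h1 r1 by (simp add: b_def)
  qed
qed

section \<open>Thresholds for \<open>n\<close> and the final constants\<close>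

lemma graph_exists_power_ratio:
  fixes \<delta> :: real assumes \<delta>: "\<delta> > 0"
  shows "\<exists>C::real. \<exists>N::nat. \<forall>n s t::nat. n \<ge> N \<longrightarrow> 1 \<le> t \<longrightarrow> t < s \<longrightarrow> 2 * s \<le> n \<longrightarrow>
         real s \<le> exp (2 * real t) \<longrightarrow>
         (real s / real t) powr (1 - \<delta>) \<ge> ln (real n) \<longrightarrow>
         (\<exists>E. graph_on n E \<and>
              real (alpha n E) \<le> C * (real t / ln (real s / real t)) * ln (real n / real t) \<and>
              s_t_property n E s t)"
proof -
  have "eventually (\<lambda>n::nat. 48 \<le> ln (real n) powr (\<delta> / 2)) at_top" using \<delta> by real_asymp
  moreover have "eventually (\<lambda>n::nat. 4 \<le> ln (real n)) at_top" by real_asymp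
  ultimately have "eventually (\<lambda>n::nat. 48 \<le> ln (real n) powr (\<delta> / 2) \<and> 4 \<le> ln (real n)) at_top"
    by (rule eventually_conj)
  then obtain N where N: "\<And>n. N \<le> n \<Longrightarrow> 48 \<le> ln (real n) powr (\<delta> / 2) \<and> 4 \<le> ln (real n)"
    unfolding eventually_at_top_linorder by blast
  show ?thesis
  proof (intro exI[of _ "64 / \<delta>"] exI[of _ N] allI impI)
    fix n s t :: nat
    assume n: "N \<le> n" and t: "1 \<le> t" "t < s" "2 * s \<le> n" and st: "real s \<le> exp (2 * real t)"
      and x: "ln (real n) \<le> (real s / real t) powr (1 - \<delta>)"
    have x1: "1 \<le> real s / real t" using t by simp
    have L: "48 \<le> ln (real n) powr (\<delta> / 2)" "4 \<le> ln (real n)" using N[OF n] by auto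
    \<comment> \<open>For \<open>\<delta> > 1\<close> the hypothesis would bound \<open>ln n\<close>
      by 1, against the choice of \<open>N\<close>.\<close>
    have d1: "\<delta> \<le> 1"
    proof (rule ccontr)
      assume "\<not> \<delta> \<le> 1"
      then have "(real s / real t) powr (1 - \<delta>) \<le> (real s / real t) powr 0"
        using x1 by (intro powr_mono) auto
      with x x1 L(2) show False by (auto split: if_splits)
    qed
    have "(real s / real t) powr (1 - \<delta>) \<le> (real s / real t) powr 1"
      using x1 \<delta> by (intro powr_mono) auto
    with x x1 have Lx: "ln (real n) \<le> real s / real t" by simp
    have "ln (real n) powr (\<delta> / 2) \<le> (real s / real t) powr (\<delta> / 2)"
      using Lx L \<delta> by (intro powr_mono2) auto
    with L have x48: "48 \<le> (real s / real t) powr (\<delta> / 2)" by linarith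
    have "4 \<le> real s / real t" "1 \<le> ln (real n)" using Lx L(2) by linarith+
    then show "\<exists>E. graph_on n E \<and>
        real (alpha n E) \<le> 64 / \<delta> * (real t / ln (real s / real t)) * ln (real n / real t) \<and> s_t_property n E s t"
      by (rule graph_exists_large_ratio[OF \<delta> d1 t st x x48])
  qed
qed

text \<open>The cases divide at \<open>x = L\<^sup>2\<close>: up to there the triangle argument
  applies, beyond it the greedy argument.\<close>

lemma graph_exists_log_ratio:
  fixes c \<gamma>' :: real assumes c: "c > 0" and \<gamma>': "\<gamma>' > 0"
  shows "\<exists>C::real. \<exists>N::nat. \<forall>n s t::nat. n \<ge> N \<longrightarrow> 1 \<le> t \<longrightarrow> t < s \<longrightarrow> 2 * s \<le> n \<longrightarrow>
         real s \<le> exp (2 * real t) \<longrightarrow>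
         real s / real t \<ge> c * ln (real n) \<longrightarrow>
         ln (real t) \<ge> ln (real n) powr \<gamma>' \<longrightarrow>
         (\<exists>E. graph_on n E \<and>
              real (alpha n E) \<le> C * (real t / ln (real s / real t)) * ln (real n / real t) \<and>
              s_t_property n E s t)"
proof -
  \<comment> \<open>Truncation at 1 meets the premise \<open>\<gamma> \<le> 1\<close> of the small
    range and only weakens the lower bound on \<open>ln t\<close>, as
    \<open>ln n \<ge> 1\<close>.\<close>
  define \<gamma> where "\<gamma> = min \<gamma>' 1"
  define \<epsilon> where "\<epsilon> = \<gamma> / 3136"
  \<comment> \<open>\<open>B\<close> forces \<open>\<epsilon> * ln x\<close> to be at least 1 and at
    least \<open>1 / c\<close>; the latter absorbs \<open>c\<close> in
    \<open>L \<le> \<epsilon> * x * ln x\<close>.\<close>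
  define B where "B = max 1 (1 / c)"
  have \<gamma>: "0 < \<gamma>" "\<gamma> \<le> 1" "\<gamma> \<le> \<gamma>'" using \<gamma>' by (auto simp: \<gamma>_def)
  have \<epsilon>: "0 < \<epsilon>" using \<gamma> by (simp add: \<epsilon>_def)
  have ev: "eventually (\<lambda>n::nat. 48 \<le> ln (real n) powr (1 / 2)) at_top"
    "eventually (\<lambda>n::nat. 4 \<le> ln (real n)) at_top"
    "eventually (\<lambda>n::nat. 8 \<le> ln (real n) powr (\<gamma> / 2)) at_top"
    "eventually (\<lambda>n::nat. ln 3 + 12 * ln (ln (real n)) \<le> ln (real n) powr \<gamma> / 2) at_top"
    "eventually (\<lambda>n::nat. 1 \<le> c * ln (real n)) at_top"
    using \<gamma>(1) c by real_asymp+
  have "filterlim (\<lambda>n::nat. \<epsilon> * ln (c * ln (real n))) at_top at_top"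
    using \<epsilon> c by real_asymp
  then have ev': "eventually (\<lambda>n::nat. B \<le> \<epsilon> * ln (c * ln (real n))) at_top"
    by (simp add: filterlim_at_top)
  obtain N where N: "\<And>n. N \<le> n \<Longrightarrow> 48 \<le> ln (real n) powr (1 / 2) \<and> 4 \<le> ln (real n) \<and>
      8 \<le> ln (real n) powr (\<gamma> / 2) \<and> ln 3 + 12 * ln (ln (real n)) \<le> ln (real n) powr \<gamma> / 2 \<and>
      1 \<le> c * ln (real n) \<and> B \<le> \<epsilon> * ln (c * ln (real n))"
    using eventually_conj[OF ev(1) eventually_conj[OF ev(2) eventually_conj[OF ev(3)
          eventually_conj[OF ev(4) eventually_conj[OF ev(5) ev']]]]]
    unfolding eventually_at_top_linorder by blast
  show ?thesis
  proof (intro exI[of _ "max 128 (16 / \<epsilon>)"] exI[of _ N] allI impI)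
    fix n s t :: nat
    assume n: "N \<le> n" and t: "1 \<le> t" "t < s" "2 * s \<le> n" and st: "real s \<le> exp (2 * real t)"
      and cx: "c * ln (real n) \<le> real s / real t" and lt: "ln (real n) powr \<gamma>' \<le> ln (real t)"
    define L where "L = ln (real n)"
    define x where "x = real s / real t"
    have L: "48 \<le> L powr (1 / 2)" "4 \<le> L" "8 \<le> L powr (\<gamma> / 2)" "ln 3 + 12 * ln L \<le> L powr \<gamma> / 2"
      "1 \<le> c * L" "B \<le> \<epsilon> * ln (c * L)"
      using N[OF n] by (auto simp: L_def)
    have x1: "1 < x" using t by (simp add: x_def)
    \<comment> \<open>Nonnegativity of this factor allows the constant of either case to be raised
      to the maximum of the two.\<close>
    have F0: "0 \<le> (real t / ln x) * ln (real n / real t)"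
      using x1 t by (intro mult_nonneg_nonneg divide_nonneg_nonneg ln_ge_zero) auto
    have "\<exists>C\<le>max 128 (16 / \<epsilon>). \<exists>E. graph_on n E \<and>
        real (alpha n E) \<le> C * (real t / ln x) * ln (real n / real t) \<and> s_t_property n E s t"
    proof (cases "x \<le> L\<^sup>2")
      case True
      have "ln (c * L) \<le> ln x" using cx L(5) x1 unfolding L_def x_def by (subst ln_le_cancel_iff) auto
      then have "\<epsilon> * ln (c * L) \<le> \<epsilon> * ln x" using \<epsilon> by (intro mult_left_mono) auto
      with L(6) have Bx: "B \<le> \<epsilon> * ln x" by linarith
      then have e1: "1 \<le> \<epsilon> * ln x" "1 / c \<le> \<epsilon> * ln x" by (simp_all add: B_def)
      have "L = (c * L) * (1 / c)" using c by simp
      also have "\<dots> \<le> x * (\<epsilon> * ln x)"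
        using cx e1(2) c x1 L(2) unfolding L_def x_def by (intro mult_mono) auto
      finally have "L \<le> \<epsilon> * x * ln x" by (simp add: mult_ac)
      moreover have "L powr \<gamma> \<le> ln (real t)"
      proof -
        have "L powr \<gamma> \<le> L powr \<gamma>'" using L \<gamma> by (intro powr_mono) auto
        with lt show ?thesis by (simp add: L_def)
      qed
      ultimately have "\<exists>E. graph_on n E \<and>
          real (alpha n E) \<le> 16 / \<epsilon> * (real t / ln x) * ln (real n / real t) \<and> s_t_property n E s t"
        using graph_exists_small_ratio[OF \<gamma>(1,2) t st] True e1 L unfolding L_def x_def \<epsilon>_def by simp
      then show ?thesis by (intro exI[of _ "16 / \<epsilon>"]) auto
    next
      case False
      then have Lx: "L\<^sup>2 \<le> x" by simp
      have sq: "(L\<^sup>2) powr a = L powr (2 * a)" for a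
        using L(2) by (simp add: powr_powr[symmetric])
      \<comment> \<open>The premises of the large range are checked with
        \<open>\<delta> = 1 / 2\<close>, whence the constant 128.\<close>
      have "L = (L\<^sup>2) powr (1 / 2)" using L(2) by (simp add: sq)
      also have "\<dots> \<le> x powr (1 / 2)" using Lx L by (intro powr_mono2) auto
      finally have 1: "L \<le> x powr (1 / 2)" .
      have "L powr (1 / 2) = (L\<^sup>2) powr (1 / 2 / 2)" by (simp add: sq)
      also have "\<dots> \<le> x powr (1 / 2 / 2)" using Lx L by (intro powr_mono2) auto
      finally have 2: "48 \<le> x powr (1 / 2 / 2)" using L(1) by linarith
      have "4 * 1 \<le> L * L" using L(2) by (intro mult_mono) auto
      then have 3: "4 \<le> x" using Lx by (simp add: power2_eq_square)
      have "\<exists>E. graph_on n E \<and>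
          real (alpha n E) \<le> 64 / (1 / 2) * (real t / ln x) * ln (real n / real t) \<and> s_t_property n E s t"
        unfolding x_def by (rule graph_exists_large_ratio)
          (use t st 1 2 3 L(2) in \<open>auto simp: x_def L_def\<close>)
      then show ?thesis by (intro exI[of _ 128]) auto
    qed
    then obtain C E where CE: "C \<le> max 128 (16 / \<epsilon>)" "graph_on n E" "s_t_property n E s t"
      "real (alpha n E) \<le> C * (real t / ln x) * ln (real n / real t)" by blast
    have "C * (real t / ln x) * ln (real n / real t) \<le> max 128 (16 / \<epsilon>) * (real t / ln x) * ln (real n / real t)"
      using mult_right_mono[OF CE(1) F0] by (simp only: mult.assoc)
    with CE show "\<exists>E. graph_on n E \<and>
        real (alpha n E) \<le> max 128 (16 / \<epsilon>) * (real t / ln (real s / real t)) * ln (real n / real t) \<and>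
        s_t_property n E s t"
      unfolding x_def by (meson order_trans)
  qed
qed

theorem theorem2p4:
  shows
  "(\<forall>\<delta>::real. \<delta> > 0 \<longrightarrow>
      (\<exists>C::real. \<exists>N::nat. \<forall>n s t::nat. n \<ge> N \<longrightarrow> 1 \<le> t \<longrightarrow> t < s \<longrightarrow> 2 * s \<le> n \<longrightarrow>
         real s \<le> exp (2 * real t) \<longrightarrow>
         (real s / real t) powr (1 - \<delta>) \<ge> ln (real n) \<longrightarrow>
         (\<exists>E. graph_on n E \<and>
              real (alpha n E) \<le> C * (real t / ln (real s / real t)) * ln (real n / real t) \<and>
              s_t_property n E s t)))
   \<and>
   (\<forall>c::real. \<forall>\<gamma>::real. c > 0 \<longrightarrow> \<gamma> > 0 \<longrightarrow>
      (\<exists>C::real. \<exists>N::nat. \<forall>n s t::nat. n \<ge> N \<longrightarrow> 1 \<le> t \<longrightarrow> t < s \<longrightarrow> 2 * s \<le> n \<longrightarrow>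
         real s \<le> exp (2 * real t) \<longrightarrow>
         real s / real t \<ge> c * ln (real n) \<longrightarrow>
         ln (real t) \<ge> ln (real n) powr \<gamma> \<longrightarrow>
         (\<exists>E. graph_on n E \<and>
              real (alpha n E) \<le> C * (real t / ln (real s / real t)) * ln (real n / real t) \<and>
              s_t_property n E s t)))"
  using graph_exists_power_ratio graph_exists_log_ratio by simp

end
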